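(* Let $a<b$, $\alpha\in(0,1)$, $\beta>0$, $y_a,y_b\in\mathbb{R}$, and let $L:(x,y,v,w,z)\mapsto L(x,y,v,w,z)$ and $l:(x,y,v,w)\mapsto l(x,y,v,w)$ be real-valued functions of class $C^1$. For $y\in\mathcal{F}([a,b];\mathbb{R})$ put $$z(x)=\int_a^x l\bigl(t,y(t),{^C_aD_t^\alpha}y(t),{_aI_t^\beta}y(t)\bigr)\,dt,$$ $\{y\}(x)=(x,y(x),{^C_aD_x^\alpha}y(x),{_aI_x^\beta}y(x))$, $[y](x)=(x,y(x),{^C_aD_x^\alpha}y(x),{_aI_x^\beta}y(x),z(x))$, and $J(y)=\int_a^b L[y](x)\,dx$. Let $y\in\mathcal{F}([a,b];\mathbb{R})$ satisfy the boundary conditions $y(a)=y_a$, $y(b)=y_b$ and be a solution of the fractional Euler--Lagrange equation $$\frac{\partial L}{\partial y}[y](x)+{_xD^\alpha_b}\left(\frac{\partial L}{\partial v}[y](x)\right)+{_xI_b^\beta}\left(\frac{\partial L}{\partial w}[y](x)\right)+\int_x^b\frac{\partial L}{\partial z}[y](t)\,dt\cdot\frac{\partial l}{\partial y}\{y\}(x)$$ $$+{_xD^\alpha_b}\left(\int_x^b\frac{\partial L}{\partial z}[y](t)\,dt\cdot\frac{\partial l}{\partial v}\{y\}(x)\right)+{_xI^\beta_b}\left(\int_x^b\frac{\partial L}{\partial z}[y](t)\,dt\cdot\frac{\partial l}{\partial w}\{y\}(x)\right)=0,\quad x\in[a,b].$$ Assume that $L$ is convex in $(y,v,w,z)$. If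 one of the following two conditions is satisfied: (1) $l$ is convex in $(y,v,w)$ and $\frac{\partial L}{\partial z}[y](x)\geq0$ for all $x\in[a,b]$; (2) $l$ is concave in $(y,v,w)$ and $\frac{\partial L}{\partial z}[y](x)\leq0$ for all $x\in[a,b]$; then $y$ is a (global) minimizer of the problem of minimizing $J$ over $\mathcal{F}([a,b];\mathbb{R})$ subject to the boundary conditions $y(a)=y_a$ and $y(b)=y_b$.
   Context: For $\gamma>0$, the left and right Riemann--Liouville fractional integrals are ${_aI_x^\gamma}f(x)=\frac{1}{\Gamma(\gamma)}\int_a^x(x-t)^{\gamma-1}f(t)\,dt$ and ${_xI_b^\gamma}f(x)=\frac{1}{\Gamma(\gamma)}\int_x^b(t-x)^{\gamma-1}f(t)\,dt$. For $\alpha\in(0,1)$, the right Riemann--Liouville fractional derivative is ${_xD_b^\alpha}f(x)=\frac{-1}{\Gamma(1-\alpha)}\frac{d}{dx}\int_x^b(t-x)^{-\alpha}f(t)\,dt$, and the left Caputo fractional derivative of an absolutely continuous $f$ is ${^C_aD_x^\alpha}f(x)=\frac{1}{\Gamma(1-\alpha)}\int_a^x(x-t)^{-\alpha}f'(t)\,dt$. $\mathcal{F}([a,b];\mathbb{R})$ denotes the class of absolutely continuous functions $y:[a,b]\to\mathbb{R}$ such that ${^C_aD_x^\alpha}y(x)$ and ${_aI_x^\beta}y(x)$ exist and are continuous on $[a,b]$. Convexity: given $k\in\{1,\ldots,n\}$ and $\Psi:D\subseteq\mathbb{R}^n\to\mathbb{R}$ such that $\partial\Psi/\partial x_i$ exist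 and are continuous for all $i\in\{k,\ldots,n\}$, $\Psi$ is convex (concave) in $(x_k,\ldots,x_n)$ if $$\Psi(x_1+\tau_1,\ldots,x_{k-1}+\tau_{k-1},x_k+\tau_k,\ldots,x_n+\tau_n)-\Psi(x_1,\ldots,x_n)\geq(\leq)\sum_{i=k}^n\frac{\partial\Psi}{\partial x_i}(x_1,\ldots,x_n)\tau_i$$ for all $(x_1,\ldots,x_n),(x_1+\tau_1,\ldots,x_n+\tau_n)\in D$. (This is the definition exactly as printed in the paper, with increments $\tau_1,\ldots,\tau_{k-1}$ also in the first $k-1$ variables.) Partial derivatives of $L$ are with respect to its named variables and are evaluated at $[y](\cdot)$; those of $l$ are evaluated at $\{y\}(\cdot)$. An expression such as ${_xD_b^\alpha}(\phi(x))$ means the operator applied to the function $\phi$, evaluated at $x$. *)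

theory Defs
  imports "HOL-Analysis.Analysis"
begin

text \<open>Fractional operators on a compact interval. A function on \<open>{a..b}\<close> is a total function
  \<open>real \<Rightarrow> real\<close> of which only the restriction to \<open>{a..b}\<close> matters. Integrals are Lebesgue
  integrals; the value of \<open>powr\<close> at base \<open>0\<close> only affects a null set.\<close>

definition left_RL_integral :: "real \<Rightarrow> real \<Rightarrow> (real \<Rightarrow> real) \<Rightarrow> real \<Rightarrow> real" where
  "left_RL_integral a \<gamma> f x =
     1 / Gamma \<gamma> * (LINT t:{a..x}|lebesgue. (x - t) powr (\<gamma> - 1) * f t)"

definition left_RL_integral_exists :: "real \<Rightarrow> real \<Rightarrow> (real \<Rightarrow> real) \<Rightarrow> real \<Rightarrow> bool" where
  "left_RL_integral_exists a \<gamma> f x \<longleftrightarrow>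
     set_integrable lebesgue {a..x} (\<lambda>t. (x - t) powr (\<gamma> - 1) * f t)"

definition right_RL_integral :: "real \<Rightarrow> real \<Rightarrow> (real \<Rightarrow> real) \<Rightarrow> real \<Rightarrow> real" where
  "right_RL_integral b \<gamma> f x =
     1 / Gamma \<gamma> * (LINT t:{x..b}|lebesgue. (t - x) powr (\<gamma> - 1) * f t)"

definition right_RL_integral_exists :: "real \<Rightarrow> real \<Rightarrow> (real \<Rightarrow> real) \<Rightarrow> real \<Rightarrow> bool" where
  "right_RL_integral_exists b \<gamma> f x \<longleftrightarrow>
     set_integrable lebesgue {x..b} (\<lambda>t. (t - x) powr (\<gamma> - 1) * f t)"

text \<open>The outer derivative is taken relative to \<open>{a..b}\<close>: two-sided inside, one-sided at the
  endpoints. This is why the left endpoint is a parameter.\<close>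

definition right_RL_derivative ::
    "real \<Rightarrow> real \<Rightarrow> real \<Rightarrow> (real \<Rightarrow> real) \<Rightarrow> real \<Rightarrow> real" where
  "right_RL_derivative a b \<alpha> f x =
     - 1 / Gamma (1 - \<alpha>) *
       vector_derivative (\<lambda>x. LINT t:{x..b}|lebesgue. (t - x) powr (- \<alpha>) * f t) (at x within {a..b})"

definition right_RL_derivative_exists ::
    "real \<Rightarrow> real \<Rightarrow> real \<Rightarrow> (real \<Rightarrow> real) \<Rightarrow> real \<Rightarrow> bool" where
  "right_RL_derivative_exists a b \<alpha> f x \<longleftrightarrow>
     (\<forall>u\<in>{a..b}. set_integrable lebesgue {u..b} (\<lambda>t. (t - u) powr (- \<alpha>) * f t)) \<and>
     (\<lambda>u. LINT t:{u..b}|lebesgue. (t - u) powr (- \<alpha>) * f t) differentiable (at x within {a..b})"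

text \<open>For absolutely continuous \<open>f\<close> the derivative exists almost everywhere, so the
  unspecified value of \<open>deriv\<close> at other points does not influence the integral.\<close>

definition left_Caputo_derivative :: "real \<Rightarrow> real \<Rightarrow> (real \<Rightarrow> real) \<Rightarrow> real \<Rightarrow> real" where
  "left_Caputo_derivative a \<alpha> f x =
     1 / Gamma (1 - \<alpha>) * (LINT t:{a..x}|lebesgue. (x - t) powr (- \<alpha>) * deriv f t)"

definition left_Caputo_derivative_exists :: "real \<Rightarrow> real \<Rightarrow> (real \<Rightarrow> real) \<Rightarrow> real \<Rightarrow> bool" where
  "left_Caputo_derivative_exists a \<alpha> f x \<longleftrightarrow>
     set_integrable lebesgue {a..x} (\<lambda>t. (x - t) powr (- \<alpha>) * deriv f t)"

text \<open>Pairs \<open>(u, v)\<close> encode the intervals \<open>{u..v}\<close>.\<close>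

definition abs_continuous_on_interval :: "real \<Rightarrow> real \<Rightarrow> (real \<Rightarrow> real) \<Rightarrow> bool" where
  "abs_continuous_on_interval a b f \<longleftrightarrow>
     (\<forall>\<epsilon>>0. \<exists>\<delta>>0. \<forall>P :: (real \<times> real) set.
        finite P \<and> (\<forall>(u, v)\<in>P. a \<le> u \<and> u \<le> v \<and> v \<le> b) \<and>
        pairwise (\<lambda>(u, v) (u', v'). disjnt {u<..<v} {u'<..<v'}) P \<and>
        (\<Sum>(u, v)\<in>P. v - u) < \<delta>
        \<longrightarrow> (\<Sum>(u, v)\<in>P. \<bar>f v - f u\<bar>) < \<epsilon>)"

definition frac_class :: "real \<Rightarrow> real \<Rightarrow> real \<Rightarrow> real \<Rightarrow> (real \<Rightarrow> real) set" where
  "frac_class a b \<alpha> \<beta> =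
     {y. abs_continuous_on_interval a b y \<and>
         (\<forall>x\<in>{a..b}. left_Caputo_derivative_exists a \<alpha> y x \<and> left_RL_integral_exists a \<beta> y x) \<and>
         continuous_on {a..b} (left_Caputo_derivative a \<alpha> y) \<and>
         continuous_on {a..b} (left_RL_integral a \<beta> y)}"

definition C1_on :: "'a::real_normed_vector set \<Rightarrow> ('a \<Rightarrow> real) \<Rightarrow> bool" where
  "C1_on D \<Psi> \<longleftrightarrow>
     (\<exists>\<Psi>' :: 'a \<Rightarrow> 'a \<Rightarrow>\<^sub>L real.
        (\<forall>p\<in>D. (\<Psi> has_derivative blinfun_apply (\<Psi>' p)) (at p within D)) \<and> continuous_on D \<Psi>')"

text \<open>Partial derivative along the coordinate direction \<open>i \<in> Basis\<close>. It is only used for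
  directions in which \<open>D\<close> contains full lines, so it depends only on the values of \<open>\<Psi>\<close> on \<open>D\<close>.\<close>

definition partial_deriv :: "'a::real_normed_vector \<Rightarrow> ('a \<Rightarrow> real) \<Rightarrow> 'a \<Rightarrow> real" where
  "partial_deriv i \<Psi> p = deriv (\<lambda>s. \<Psi> (p + s *\<^sub>R i)) 0"

definition has_continuous_partials_on ::
    "'a::real_normed_vector set \<Rightarrow> 'a set \<Rightarrow> ('a \<Rightarrow> real) \<Rightarrow> bool" where
  "has_continuous_partials_on I D \<Psi> \<longleftrightarrow>
     (\<forall>i\<in>I. (\<forall>p\<in>D. (\<lambda>s. \<Psi> (p + s *\<^sub>R i)) field_differentiable at 0) \<and>
            continuous_on D (partial_deriv i \<Psi>))"

text \<open>Convexity (concavity) in the variables whose unit vectors form \<open>I \<subseteq> Basis\<close>. Pitfall: the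
  increment \<open>\<tau>\<close> is not restricted to the span of \<open>I\<close>; the remaining variables are incremented as
  well, but do not contribute to the sum.\<close>

definition convex_in_vars :: "'a::euclidean_space set \<Rightarrow> 'a set \<Rightarrow> ('a \<Rightarrow> real) \<Rightarrow> bool" where
  "convex_in_vars I D \<Psi> \<longleftrightarrow> has_continuous_partials_on I D \<Psi> \<and>
     (\<forall>p \<tau>. p \<in> D \<and> p + \<tau> \<in> D \<longrightarrow> \<Psi> (p + \<tau>) - \<Psi> p \<ge> (\<Sum>i\<in>I. partial_deriv i \<Psi> p * (\<tau> \<bullet> i)))"

definition concave_in_vars :: "'a::euclidean_space set \<Rightarrow> 'a set \<Rightarrow> ('a \<Rightarrow> real) \<Rightarrow> bool" where
  "concave_in_vars I D \<Psi> \<longleftrightarrow> has_continuous_partials_on I D \<Psi> \<and>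
     (\<forall>p \<tau>. p \<in> D \<and> p + \<tau> \<in> D \<longrightarrow> \<Psi> (p + \<tau>) - \<Psi> p \<le> (\<Sum>i\<in>I. partial_deriv i \<Psi> p * (\<tau> \<bullet> i)))"

type_synonym point4 = "real \<times> real \<times> real \<times> real"
type_synonym point5 = "real \<times> real \<times> real \<times> real \<times> real"

text \<open>\<open>curly\<close> is \<open>{y}(x)\<close>, \<open>indef\<close> is \<open>z(x)\<close> and \<open>bracket\<close> is \<open>[y](x)\<close>.\<close>

definition curly :: "real \<Rightarrow> real \<Rightarrow> real \<Rightarrow> (real \<Rightarrow> real) \<Rightarrow> real \<Rightarrow> point4" where
  "curly a \<alpha> \<beta> y x = (x, y x, left_Caputo_derivative a \<alpha> y x, left_RL_integral a \<beta> y x)"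

definition indef ::
    "real \<Rightarrow> real \<Rightarrow> real \<Rightarrow> (point4 \<Rightarrow> real) \<Rightarrow> (real \<Rightarrow> real) \<Rightarrow> real \<Rightarrow> real" where
  "indef a \<alpha> \<beta> l y x = (LINT t:{a..x}|lebesgue. l (curly a \<alpha> \<beta> y t))"

definition bracket ::
    "real \<Rightarrow> real \<Rightarrow> real \<Rightarrow> (point4 \<Rightarrow> real) \<Rightarrow> (real \<Rightarrow> real) \<Rightarrow> real \<Rightarrow> point5" where
  "bracket a \<alpha> \<beta> l y x =
     (x, y x, left_Caputo_derivative a \<alpha> y x, left_RL_integral a \<beta> y x, indef a \<alpha> \<beta> l y x)"

definition functional_J ::
    "real \<Rightarrow> real \<Rightarrow> real \<Rightarrow> real \<Rightarrow> (point5 \<Rightarrow> real) \<Rightarrow> (point4 \<Rightarrow> real) \<Rightarrow> (real \<Rightarrow> real) \<Rightarrow> real" where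
  "functional_J a b \<alpha> \<beta> L l y = (LINT x:{a..b}|lebesgue. L (bracket a \<alpha> \<beta> l y x))"

text \<open>Being a solution includes the existence of every fractional operator in the equation.\<close>

definition Euler_Lagrange_solution ::
    "real \<Rightarrow> real \<Rightarrow> real \<Rightarrow> real \<Rightarrow> (point5 \<Rightarrow> real) \<Rightarrow> (point4 \<Rightarrow> real) \<Rightarrow> (real \<Rightarrow> real) \<Rightarrow> bool" where
  "Euler_Lagrange_solution a b \<alpha> \<beta> L l y \<longleftrightarrow>
     (let L\<^sub>y = (\<lambda>x. partial_deriv (0,1,0,0,0) L (bracket a \<alpha> \<beta> l y x));
          L\<^sub>v = (\<lambda>x. partial_deriv (0,0,1,0,0) L (bracket a \<alpha> \<beta> l y x));
          L\<^sub>w = (\<lambda>x. partial_deriv (0,0,0,1,0) L (bracket a \<alpha> \<beta> l y x));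
          L\<^sub>z = (\<lambda>x. partial_deriv (0,0,0,0,1) L (bracket a \<alpha> \<beta> l y x));
          l\<^sub>y = (\<lambda>x. partial_deriv (0,1,0,0) l (curly a \<alpha> \<beta> y x));
          l\<^sub>v = (\<lambda>x. partial_deriv (0,0,1,0) l (curly a \<alpha> \<beta> y x));
          l\<^sub>w = (\<lambda>x. partial_deriv (0,0,0,1) l (curly a \<alpha> \<beta> y x));
          \<Phi> = (\<lambda>x. LINT t:{x..b}|lebesgue. L\<^sub>z t)
      in \<forall>x\<in>{a..b}.
           right_RL_derivative_exists a b \<alpha> L\<^sub>v x \<and>
           right_RL_integral_exists b \<beta> L\<^sub>w x \<and>
           right_RL_derivative_exists a b \<alpha> (\<lambda>u. \<Phi> u * l\<^sub>v u) x \<and>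
           right_RL_integral_exists b \<beta> (\<lambda>u. \<Phi> u * l\<^sub>w u) x \<and>
           L\<^sub>y x + right_RL_derivative a b \<alpha> L\<^sub>v x + right_RL_integral b \<beta> L\<^sub>w x + \<Phi> x * l\<^sub>y x
           + right_RL_derivative a b \<alpha> (\<lambda>u. \<Phi> u * l\<^sub>v u) x
           + right_RL_integral b \<beta> (\<lambda>u. \<Phi> u * l\<^sub>w u) x = 0)"

end

theory Submission
  imports Defs
begin

text \<open>Write \<open>h = u - y\<close> for a competitor \<open>u\<close>. Convexity of \<open>L\<close>, together with convexity or concavity of
  \<open>l\<close> and the sign of \<open>\<partial>L/\<partial>z\<close>, bounds \<open>J(u) - J(y)\<close> from below by the first variation at \<open>y\<close> in
  direction \<open>h\<close>. Fubini's theorem moves every operator off \<open>h\<close>, and the Euler--Lagrange equation says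
  that what multiplies \<open>h\<close> vanishes.

  The delicate term is \<open>\<integral> g \<cdot> D\<^sup>\<alpha>h\<close> with \<open>g = \<partial>L/\<partial>v + \<Phi> \<cdot> \<partial>l/\<partial>v\<close>, since \<open>g\<close> is merely continuous.
  Here \<open>G(x) = \<integral>\<^sub>x\<^sup>b (t - x)\<^sup>-\<^sup>\<alpha> g(t) dt\<close> is differentiable everywhere, and the Euler--Lagrange equation
  itself shows that \<open>G'\<close> is bounded. Hence \<open>G\<close> is the integral of \<open>G'\<close>, and as \<open>G(b) = 0\<close> the
  integration by parts needs only \<open>h(a) = 0\<close>. It also needs the fundamental theorem of calculus for
  absolutely continuous functions, which is obtained from the total variation, the
  Radon--Nikodym theorem and Lebesgue's differentiation theorem.\<close>

section \<open>Absolute continuity and total variation\<close>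

text \<open>Unlike in \<^const>\<open>abs_continuous_on_interval\<close>, the intervals are nondegenerate, so that distinct pairs have distinct endpoints.\<close>

definition interval_system :: "real \<Rightarrow> real \<Rightarrow> (real \<times> real) set \<Rightarrow> bool" where
  "interval_system a b P \<longleftrightarrow> finite P \<and> (\<forall>(u, v)\<in>P. a \<le> u \<and> u < v \<and> v \<le> b) \<and>
     pairwise (\<lambda>(u, v) (u', v'). disjnt {u<..<v} {u'<..<v'}) P"

definition variation :: "(real \<Rightarrow> real) \<Rightarrow> (real \<times> real) set \<Rightarrow> real" where
  "variation f P = (\<Sum>(u, v)\<in>P. \<bar>f v - f u\<bar>)"

definition total_length :: "(real \<times> real) set \<Rightarrow> real" where
  "total_length P = (\<Sum>(u, v)\<in>P. v - u)"

definition AC_on :: "real \<Rightarrow> real \<Rightarrow> (real \<Rightarrow> real) \<Rightarrow> bool" where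
  "AC_on a b f \<longleftrightarrow>
     (\<forall>\<epsilon>>0. \<exists>\<delta>>0. \<forall>P. interval_system a b P \<and> total_length P < \<delta> \<longrightarrow> variation f P < \<epsilon>)"

lemma abs_continuous_imp_AC_on:
  assumes "abs_continuous_on_interval a b f"
  shows "AC_on a b f"
  unfolding AC_on_def
proof (intro allI impI)
  fix \<epsilon> :: real assume "\<epsilon> > 0"
  then obtain \<delta> where "\<delta> > 0" and d: "\<And>P. finite P \<and> (\<forall>(u, v)\<in>P. a \<le> u \<and> u \<le> v \<and> v \<le> b) \<and>
        pairwise (\<lambda>(u, v) (u', v'). disjnt {u<..<v} {u'<..<v'}) P \<and>
        (\<Sum>(u, v)\<in>P. v - u) < \<delta> \<Longrightarrow> (\<Sum>(u, v)\<in>P. \<bar>f v - f u\<bar>) < \<epsilon>"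
    using assms unfolding abs_continuous_on_interval_def by meson
  have "variation f P < \<epsilon>" if "interval_system a b P" "total_length P < \<delta>" for P
    unfolding variation_def
    by (rule d) (use that in \<open>auto simp: interval_system_def total_length_def less_imp_le\<close>)
  with \<open>\<delta> > 0\<close> show "\<exists>\<delta>>0. \<forall>P. interval_system a b P \<and> total_length P < \<delta> \<longrightarrow> variation f P < \<epsilon>"
    by blast
qed

section \<open>Truncating, extending and measuring disjoint interval systems\<close>

lemma interval_system_memD:
  assumes "interval_system a b P" "(u, v) \<in> P"
  shows "a \<le> u" "u < v" "v \<le> b"
  using assms unfolding interval_system_def by auto

text \<open>Disjointness in pointwise form: one common interior point forces two members to
  coincide. Every later proof that a family is a system works by exhibiting such a point.\<close>

lemma interval_system_disjoint:
  assumes "interval_system a b P" "p \<in> P" "q \<in> P" "x \<in> {fst p<..<snd p}" "x \<in> {fst q<..<snd q}"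
  shows "p = q"
  using assms unfolding interval_system_def pairwise_def disjnt_def by (cases p; cases q) fastforce

lemma interval_systemI:
  assumes "finite P" "\<And>u v. (u, v) \<in> P \<Longrightarrow> a \<le> u \<and> u < v \<and> v \<le> b"
    and "\<And>p q x. \<lbrakk>p \<in> P; q \<in> P; x \<in> {fst p<..<snd p}; x \<in> {fst q<..<snd q}\<rbrakk> \<Longrightarrow> p = q"
  shows "interval_system a b P"
  unfolding interval_system_def pairwise_def disjnt_def
proof (intro conjI ballI impI)
  fix p q assume "p \<in> P" "q \<in> P" "p \<noteq> q"
  then have "{fst p<..<snd p} \<inter> {fst q<..<snd q} = {}" using assms(3) by blast
  then show "(case p of (u, v) \<Rightarrow> \<lambda>(u', v'). {u<..<v} \<inter> {u'<..<v'} = {}) q"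
    by (simp add: case_prod_unfold)
qed (use assms in auto)

lemma interval_system_empty: "interval_system a b {}"
  by (simp add: interval_system_def)

text \<open>Nondegenerate intervals with a common left end overlap; the midpoint between that end
  and the smaller right end lies in both. This lemma and its mirror image make truncation at a point
  injective in \<open>interval_system_split\<close>.\<close>

lemma interval_system_inj_fst:
  assumes "interval_system a b P" "p \<in> P" "q \<in> P" "fst p = fst q"
  shows "p = q"
proof (rule interval_system_disjoint[OF assms(1-3)])
  have "fst p < snd p" "fst q < snd q"
    using interval_system_memD(2)[OF assms(1)] assms by (metis prod.collapse)+
  then show "(fst p + min (snd p) (snd q)) / 2 \<in> {fst p<..<snd p}"
    "(fst p + min (snd p) (snd q)) / 2 \<in> {fst q<..<snd q}"
    using assms(4) by (auto simp: min_def)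
qed

lemma interval_system_inj_snd:
  assumes "interval_system a b P" "p \<in> P" "q \<in> P" "snd p = snd q"
  shows "p = q"
proof (rule interval_system_disjoint[OF assms(1-3)])
  have "fst p < snd p" "fst q < snd q"
    using interval_system_memD(2)[OF assms(1)] assms by (metis prod.collapse)+
  then show "(snd p + max (fst p) (fst q)) / 2 \<in> {fst p<..<snd p}"
    "(snd p + max (fst p) (fst q)) / 2 \<in> {fst q<..<snd q}"
    using assms(4) by (auto simp: max_def)
qed

text \<open>Length becomes the Lebesgue measure of a disjoint union, so that it can be bounded by
  inclusion in an interval or in an open set.\<close>

lemma total_length_eq_measure:
  assumes P: "interval_system a b P"
  shows "total_length P = measure lborel (\<Union>p\<in>P. {fst p<..<snd p})"
proof -
  have fin: "finite P" using P by (simp add: interval_system_def)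
  have "disjoint_family_on (\<lambda>p. {fst p<..<snd p}) P"
    unfolding disjoint_family_on_def using interval_system_disjoint[OF P] by blast
  then have "measure lborel (\<Union>p\<in>P. {fst p<..<snd p}) = (\<Sum>p\<in>P. measure lborel {fst p<..<snd p})"
    using emeasure_lborel_box_finite[where ?'a = real]
    by (intro measure_finite_Union fin) (auto simp: less_top[symmetric])
  also have "\<dots> = total_length P"
    unfolding total_length_def using interval_system_memD(2)[OF P]
    by (intro sum.cong) (auto simp: less_imp_le)
  finally show ?thesis ..
qed

lemma total_length_le:
  assumes P: "interval_system a b P" and "a \<le> b"
  shows "total_length P \<le> b - a"
proof -
  have "total_length P = measure lborel (\<Union>p\<in>P. {fst p<..<snd p})"
    by (rule total_length_eq_measure[OF P])
  also have "\<dots> \<le> measure lborel {a..b}"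
  proof (rule measure_mono_fmeasurable)
    show "(\<Union>p\<in>P. {fst p<..<snd p}) \<subseteq> {a..b}"
      using interval_system_memD[OF P] by force
    show "{a..b} \<in> fmeasurable lborel"
      using \<open>a \<le> b\<close> by (intro fmeasurableI) simp_all
  qed (use P in \<open>auto simp: interval_system_def\<close>)
  also have "\<dots> = b - a" using \<open>a \<le> b\<close> by simp
  finally show ?thesis .
qed

lemma interval_system_mono:
  assumes "interval_system c d P" "a \<le> c" "d \<le> b"
  shows "interval_system a b P"
  using assms unfolding interval_system_def by fastforce

text \<open>Each interval is cut at \<open>c\<close>. At most the triangle inequality is spent, and
  only on a member that straddles \<open>c\<close>.\<close>

lemma interval_system_split:
  assumes P: "interval_system a b P" and c: "a \<le> c" "c \<le> b"
  obtains P1 P2 where "interval_system a c P1" "interval_system c b P2"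
    "variation f P \<le> variation f P1 + variation f P2"
proof -
  \<comment> \<open>A straddling interval belongs to both \<open>A\<close> and \<open>B\<close>;
    \<open>g\<close> keeps its left piece and \<open>h\<close> its right piece. Every piece kept is
    nondegenerate, as \<open>interval_system\<close> demands.\<close>
  define A where "A = {p\<in>P. fst p < c}"
  define B where "B = {p\<in>P. c < snd p}"
  define g where "g = (\<lambda>p::real\<times>real. (fst p, min (snd p) c))"
  define h where "h = (\<lambda>p::real\<times>real. (max (fst p) c, snd p))"
  have fin: "finite P" using P by (simp add: interval_system_def)
  note mem = interval_system_memD[OF P]
  have injg: "inj_on g A" and injh: "inj_on h B"
    unfolding inj_on_def A_def B_def g_def h_def
    using interval_system_inj_fst[OF P] interval_system_inj_snd[OF P] by auto
  have sys1: "interval_system a c (g ` A)"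
  proof (rule interval_systemI)
    fix p q x assume "p \<in> g ` A" "q \<in> g ` A" "x \<in> {fst p<..<snd p}" "x \<in> {fst q<..<snd q}"
    then obtain p' q' where "p' \<in> P" "q' \<in> P" and eq: "p = g p'" "q = g q'"
        and "x \<in> {fst p'<..<snd p'}" "x \<in> {fst q'<..<snd q'}"
      by (auto simp: A_def g_def)
    then have "p' = q'" using interval_system_disjoint[OF P] by blast
    then show "p = q" using eq by simp
  qed (use fin mem in \<open>auto simp: A_def g_def\<close>)
  have sys2: "interval_system c b (h ` B)"
  proof (rule interval_systemI)
    fix p q x assume "p \<in> h ` B" "q \<in> h ` B" "x \<in> {fst p<..<snd p}" "x \<in> {fst q<..<snd q}"
    then obtain p' q' where "p' \<in> P" "q' \<in> P" and eq: "p = h p'" "q = h q'"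
        and "x \<in> {fst p'<..<snd p'}" "x \<in> {fst q'<..<snd q'}"
      by (auto simp: B_def h_def)
    then have "p' = q'" using interval_system_disjoint[OF P] by blast
    then show "p = q" using eq by simp
  qed (use fin mem in \<open>auto simp: B_def h_def\<close>)
  have "variation f P = (\<Sum>p\<in>P. \<bar>f (snd p) - f (fst p)\<bar>)"
    by (simp add: variation_def case_prod_unfold)
  \<comment> \<open>A member on one side of \<open>c\<close> contributes its own increment through
    exactly one guard. Both guards are open precisely for a straddling member.\<close>
  also have "\<dots> \<le> (\<Sum>p\<in>P. (if fst p < c then \<bar>f (snd (g p)) - f (fst (g p))\<bar> else 0)
      + (if c < snd p then \<bar>f (snd (h p)) - f (fst (h p))\<bar> else 0))"
  proof (intro sum_mono)
    fix p assume "p \<in> P"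
    then have "fst p < snd p" using mem(2)[of "fst p" "snd p"] by simp
    then show "\<bar>f (snd p) - f (fst p)\<bar>
      \<le> (if fst p < c then \<bar>f (snd (g p)) - f (fst (g p))\<bar> else 0)
        + (if c < snd p then \<bar>f (snd (h p)) - f (fst (h p))\<bar> else 0)"
      by (auto simp: g_def h_def min_def max_def)
  qed
  also have "\<dots> = (\<Sum>p\<in>A. \<bar>f (snd (g p)) - f (fst (g p))\<bar>) + (\<Sum>p\<in>B. \<bar>f (snd (h p)) - f (fst (h p))\<bar>)"
    unfolding A_def B_def using fin by (simp add: sum.distrib sum.inter_filter)
  also have "\<dots> = variation f (g ` A) + variation f (h ` B)"
    by (simp add: variation_def case_prod_unfold sum.reindex[OF injg] sum.reindex[OF injh])
  finally show ?thesis using that sys1 sys2 by blast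
qed

lemma interval_system_insert:
  assumes P: "interval_system a c P" and "a \<le> c" "c < d"
  shows "interval_system a d (insert (c, d) P)"
    and "variation f (insert (c, d) P) = variation f P + \<bar>f d - f c\<bar>"
proof -
  have fin: "finite P" using P by (simp add: interval_system_def)
  have "(c, d) \<notin> P" using interval_system_memD[OF P] assms by force
  then show "variation f (insert (c, d) P) = variation f P + \<bar>f d - f c\<bar>"
    using fin by (simp add: variation_def)
  show "interval_system a d (insert (c, d) P)"
  proof (rule interval_systemI)
    fix p q x assume *: "p \<in> insert (c, d) P" "q \<in> insert (c, d) P"
      "x \<in> {fst p<..<snd p}" "x \<in> {fst q<..<snd q}"
    have le: "snd r \<le> c" if "r \<in> P" for r
      using interval_system_memD(3)[OF P, of "fst r" "snd r"] that by simp
    show "p = q"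
    proof (cases "p \<in> P \<and> q \<in> P")
      case True
      then show ?thesis using interval_system_disjoint[OF P, of p q x] * by blast
    next
      case False
      then show ?thesis using * le[of p] le[of q] by auto
    qed
  qed (use fin assms interval_system_memD[OF P] in force)+
qed

section \<open>Bounded variation and the total variation function\<close>

text \<open>The interval is covered by finitely many pieces shorter than the \<delta> that belongs
  to \<epsilon> = 1. Each piece contributes variation below 1, so the number of pieces is a
  bound.\<close>

lemma AC_on_variation_bounded:
  assumes ac: "AC_on a b f"
  shows "\<exists>B. \<forall>P. interval_system a b P \<longrightarrow> variation f P \<le> B"
proof -
  obtain \<delta> where "\<delta> > 0" and d: "\<And>P. interval_system a b P \<Longrightarrow> total_length P < \<delta> \<Longrightarrow> variation f P < 1"
    using ac[unfolded AC_on_def] zero_less_one by meson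
  \<comment> \<open>Induction on the number \<open>n\<close> of pieces, peeling off the rightmost
    one; the right end \<open>c\<close> therefore has to vary.\<close>
  have *: "variation f P \<le> real n" if "interval_system a c P" "a \<le> c" "c \<le> b" "c - a \<le> real n * (\<delta> / 2)"
    for n c P
    using that
  proof (induction n arbitrary: c P)
    case 0
    then have "P = {}" using interval_system_memD[OF 0(1)] by fastforce
    then show ?case by (simp add: variation_def)
  next
    case (Suc n)
    \<comment> \<open>Steps of \<open>\<delta> / 2\<close> keep the last piece strictly shorter than
      \<delta>, and the maximum stops the cut at \<open>a\<close>.\<close>
    define c' where "c' = max a (c - \<delta> / 2)"
    have c': "a \<le> c'" "c' \<le> c" using Suc.prems \<open>\<delta> > 0\<close> by (auto simp: c'_def)
    obtain P1 P2 where s: "interval_system a c' P1" "interval_system c' c P2"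
      "variation f P \<le> variation f P1 + variation f P2"
      using interval_system_split[OF Suc.prems(1) c'] by blast
    have "c' - a \<le> real n * (\<delta> / 2)"
      using Suc.prems(4) \<open>\<delta> > 0\<close> by (auto simp: c'_def max_def algebra_simps)
    then have "variation f P1 \<le> real n"
      using Suc.IH[OF s(1)] c' Suc.prems by auto
    moreover have "total_length P2 < \<delta>"
      using total_length_le[OF s(2)] c' \<open>\<delta> > 0\<close> by (auto simp: c'_def max_def split: if_splits)
    then have "variation f P2 < 1"
      using d[OF interval_system_mono[OF s(2)]] c' Suc.prems by auto
    ultimately show ?case using s(3) by simp
  qed
  obtain n :: nat where "b - a \<le> real n * (\<delta> / 2)"
    using reals_Archimedean3[of "\<delta> / 2"] \<open>\<delta> > 0\<close> by (metis half_gt_zero less_imp_le)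
  show ?thesis
  proof (cases "a \<le> b")
    case True
    with * \<open>b - a \<le> real n * (\<delta> / 2)\<close> show ?thesis by blast
  next
    case False
    then have "P = {}" if "interval_system a b P" for P
      using interval_system_memD[OF that] by fastforce
    then show ?thesis by (metis order_refl)
  qed
qed

definition total_variation :: "(real \<Rightarrow> real) \<Rightarrow> real \<Rightarrow> real \<Rightarrow> real" where
  "total_variation f a x = Sup (variation f ` {P. interval_system a x P})"

context
  fixes a b :: real and f :: "real \<Rightarrow> real"
  assumes ac: "AC_on a b f"
begin

text \<open>\<open>Sup\<close> on the reals is meaningful only for nonempty bounded sets; this
  supplies the bound for every supremum below.\<close>

lemma variation_bdd_above:
  assumes "a \<le> c" "c \<le> d" "d \<le> b"
  shows "bdd_above (variation f ` {P. interval_system c d P})"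
  using AC_on_variation_bounded[OF ac] interval_system_mono[of c d _ a b] assms
  unfolding bdd_above_def by (metis (mono_tags, lifting) imageE mem_Collect_eq)

lemma variation_le_total_variation:
  assumes "interval_system a x P" "a \<le> x" "x \<le> b"
  shows "variation f P \<le> total_variation f a x"
  unfolding total_variation_def
  by (rule cSUP_upper[OF _ variation_bdd_above]) (use assms in auto)

text \<open>Append the interval from \<open>c\<close> to \<open>d\<close> to an arbitrary system up
  to \<open>c\<close> and take the supremum. The inequality makes both the total variation and its
  difference with \<open>f\<close> nondecreasing.\<close>

lemma total_variation_increment:
  assumes "a \<le> c" "c \<le> d" "d \<le> b"
  shows "total_variation f a c + \<bar>f d - f c\<bar> \<le> total_variation f a d"
proof (cases "c = d")
  case False
  have "total_variation f a c \<le> total_variation f a d - \<bar>f d - f c\<bar>"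
    unfolding total_variation_def[of f a c]
  proof (rule cSUP_least)
    fix P assume "P \<in> {P. interval_system a c P}"
    then have P: "interval_system a c P" by simp
    have "c < d" "a \<le> d" using False assms by auto
    then show "variation f P \<le> total_variation f a d - \<bar>f d - f c\<bar>"
      using variation_le_total_variation[OF interval_system_insert(1)[OF P assms(1) \<open>c < d\<close>] \<open>a \<le> d\<close> assms(3)]
        interval_system_insert(2)[OF P assms(1) \<open>c < d\<close>, of f] by simp
  qed (use interval_system_empty in auto)
  then show ?thesis by simp
qed simp

text \<open>Split a nearly optimal system on \<open>{a..d}\<close> at \<open>c\<close>. Its left
  half is worth at most the total variation up to \<open>c\<close>, so the right half carries the
  increment up to the error \<open>e\<close>.\<close>

lemma total_variation_approx:
  assumes "a \<le> c" "c \<le> d" "d \<le> b" "e > 0"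
  obtains Q where "interval_system c d Q" "total_variation f a d - total_variation f a c \<le> variation f Q + e"
proof -
  have "\<exists>P\<in>{P. interval_system a d P}. total_variation f a d - e < variation f P"
    unfolding total_variation_def
    using less_cSUP_iff[of "{P. interval_system a d P}" "variation f" "Sup (variation f ` {P. interval_system a d P}) - e"]
      interval_system_empty variation_bdd_above[of a d] assms by auto
  then obtain P where P: "interval_system a d P" "total_variation f a d - e < variation f P" by blast
  obtain P1 P2 where s: "interval_system a c P1" "interval_system c d P2"
      "variation f P \<le> variation f P1 + variation f P2"
    using interval_system_split[OF P(1)] assms by blast
  have "variation f P1 \<le> total_variation f a c"
    using variation_le_total_variation[OF s(1)] assms by auto
  then show ?thesis using that[OF s(2)] s P by simp
qed

text \<open>Refine every interval of \<open>P\<close> by a system that nearly attains the increment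
  of the total variation there. The union of the refinements is no longer than \<open>P\<close>, so
  the \<delta> chosen for \<open>f\<close> with \<epsilon>/2 controls it.\<close>

lemma AC_on_total_variation: "AC_on a b (total_variation f a)"
  unfolding AC_on_def
proof (intro allI impI)
  fix \<epsilon> :: real assume "\<epsilon> > 0"
  then obtain \<delta> where "\<delta> > 0"
    and d: "\<And>P. interval_system a b P \<Longrightarrow> total_length P < \<delta> \<Longrightarrow> variation f P < \<epsilon> / 2"
    using ac[unfolded AC_on_def] half_gt_zero by meson
  have "variation (total_variation f a) P < \<epsilon>" if P: "interval_system a b P" "total_length P < \<delta>" for P
  proof -
    have fin: "finite P" using P by (simp add: interval_system_def)
    note mem = interval_system_memD[OF P(1)]
    \<comment> \<open>The errors of all members add up to at most \<epsilon>/2; the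
      \<open>+ 1\<close> keeps the denominator positive when \<open>P\<close> is empty.\<close>
    define e where "e = \<epsilon> / (2 * (real (card P) + 1))"
    have "e > 0" using \<open>\<epsilon> > 0\<close> by (simp add: e_def)
    have "\<exists>Q. interval_system (fst p) (snd p) Q \<and>
        total_variation f a (snd p) - total_variation f a (fst p) \<le> variation f Q + e" if "p \<in> P" for p
      using total_variation_approx[of "fst p" "snd p" e] mem[of "fst p" "snd p"] that \<open>e > 0\<close>
      by (metis less_imp_le prod.collapse)
    then obtain Q where Q: "\<And>p. p \<in> P \<Longrightarrow> interval_system (fst p) (snd p) (Q p)"
      and Qv: "\<And>p. p \<in> P \<Longrightarrow>
        total_variation f a (snd p) - total_variation f a (fst p) \<le> variation f (Q p) + e"
      by metis
    define R where "R = (\<Union>p\<in>P. Q p)"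
    have finQ: "finite (Q p)" if "p \<in> P" for p using Q[OF that] by (simp add: interval_system_def)
    \<comment> \<open>Intervals of different refinements cannot overlap, since each lies inside its
      parent. This gives the system property of \<open>R\<close> and also the disjointness of the
      sets \<open>Q p\<close>, which lets the sums split.\<close>
    have same: "p = p'" if "p \<in> P" "p' \<in> P" "q \<in> Q p" "q' \<in> Q p'"
      "x \<in> {fst q<..<snd q}" "x \<in> {fst q'<..<snd q'}" for p p' q q' x
    proof (rule interval_system_disjoint[OF P(1) that(1,2)])
      show "x \<in> {fst p<..<snd p}"
        using interval_system_memD[OF Q[OF that(1)], of "fst q" "snd q"] that by auto
      show "x \<in> {fst p'<..<snd p'}"
        using interval_system_memD[OF Q[OF that(2)], of "fst q'" "snd q'"] that by auto
    qed
    have disj: "Q p \<inter> Q p' = {}" if "p \<in> P" "p' \<in> P" "p \<noteq> p'" for p p'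
    proof (rule ccontr)
      assume "Q p \<inter> Q p' \<noteq> {}"
      then obtain q where q: "q \<in> Q p" "q \<in> Q p'" by blast
      have "fst q < snd q" using interval_system_memD(2)[OF Q[OF that(1)], of "fst q" "snd q"] q by simp
      then have "(fst q + snd q) / 2 \<in> {fst q<..<snd q}" by auto
      then show False using same[OF that(1,2) q] that by blast
    qed
    have sysR: "interval_system a b R"
    proof (rule interval_systemI)
      show "finite R" unfolding R_def using fin finQ by auto
      show "a \<le> u \<and> u < v \<and> v \<le> b" if uv: "(u, v) \<in> R" for u v
      proof -
        obtain p where p: "p \<in> P" "(u, v) \<in> Q p" using uv by (auto simp: R_def)
        then show ?thesis
          using interval_system_memD[OF Q[OF p(1)] p(2)] mem[of "fst p" "snd p"] by simp
      qed
      show "p = q" if pq: "p \<in> R" "q \<in> R" "x \<in> {fst p<..<snd p}" "x \<in> {fst q<..<snd q}" for p q x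
      proof -
        obtain p' q' where *: "p' \<in> P" "q' \<in> P" "p \<in> Q p'" "q \<in> Q q'" using pq by (auto simp: R_def)
        then have "p' = q'" using same pq by blast
        then show ?thesis using interval_system_disjoint[OF Q[OF *(1)]] * pq by blast
      qed
    qed
    have "total_length R = (\<Sum>p\<in>P. total_length (Q p))"
      unfolding R_def total_length_def by (rule sum.UNION_disjoint) (use fin finQ disj in auto)
    also have "\<dots> \<le> (\<Sum>p\<in>P. snd p - fst p)"
      using mem by (intro sum_mono total_length_le Q) (auto simp: less_imp_le)
    also have "\<dots> < \<delta>" using P(2) by (simp add: total_length_def case_prod_unfold)
    finally have "variation f R < \<epsilon> / 2" using d[OF sysR] by simp
    moreover have "variation f R = (\<Sum>p\<in>P. variation f (Q p))"
      unfolding R_def variation_def by (rule sum.UNION_disjoint) (use fin finQ disj in auto)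
    moreover have "variation (total_variation f a) P \<le> (\<Sum>p\<in>P. variation f (Q p) + e)"
      unfolding variation_def[of "total_variation f a"] case_prod_unfold
    proof (intro sum_mono)
      fix p assume p: "p \<in> P"
      have "total_variation f a (fst p) \<le> total_variation f a (snd p)"
        using total_variation_increment[of "fst p" "snd p"] mem[of "fst p" "snd p"] p by simp
      then show "\<bar>total_variation f a (snd p) - total_variation f a (fst p)\<bar> \<le> variation f (Q p) + e"
        using Qv[OF p] by simp
    qed
    moreover have "(\<Sum>p\<in>P. variation f (Q p) + e) = (\<Sum>p\<in>P. variation f (Q p)) + real (card P) * e"
      by (simp add: sum.distrib)
    moreover have "real (card P) * e \<le> \<epsilon> / 2"
      using \<open>\<epsilon> > 0\<close> by (simp add: e_def field_simps)
    ultimately show ?thesis by linarith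
  qed
  with \<open>\<delta> > 0\<close> show "\<exists>\<delta>>0. \<forall>P. interval_system a b P \<and> total_length P < \<delta>
      \<longrightarrow> variation (total_variation f a) P < \<epsilon>" by blast
qed

end

lemma AC_on_diff:
  assumes "AC_on a b f" "AC_on a b g"
  shows "AC_on a b (\<lambda>x. f x - g x)"
  unfolding AC_on_def
proof (intro allI impI)
  fix \<epsilon> :: real assume "\<epsilon> > 0"
  obtain \<delta> where "\<delta> > 0"
    and d: "\<And>P. interval_system a b P \<Longrightarrow> total_length P < \<delta> \<Longrightarrow> variation f P < \<epsilon> / 2"
    using assms(1)[unfolded AC_on_def] half_gt_zero[OF \<open>\<epsilon> > 0\<close>] by meson
  obtain \<delta>' where "\<delta>' > 0"
    and d': "\<And>P. interval_system a b P \<Longrightarrow> total_length P < \<delta>' \<Longrightarrow> variation g P < \<epsilon> / 2"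
    using assms(2)[unfolded AC_on_def] half_gt_zero[OF \<open>\<epsilon> > 0\<close>] by meson
  have "variation (\<lambda>x. f x - g x) P \<le> variation f P + variation g P" for P
    unfolding variation_def sum.distrib[symmetric] case_prod_unfold by (intro sum_mono) auto
  then have "variation (\<lambda>x. f x - g x) P < \<epsilon>" if "interval_system a b P" "total_length P < min \<delta> \<delta>'" for P
    using d[OF that(1)] d'[OF that(1)] that(2) by (smt (verit) field_sum_of_halves)
  moreover have "min \<delta> \<delta>' > 0" using \<open>\<delta> > 0\<close> \<open>\<delta>' > 0\<close> by simp
  ultimately show "\<exists>\<delta>>0. \<forall>P. interval_system a b P \<and> total_length P < \<delta>
      \<longrightarrow> variation (\<lambda>x. f x - g x) P < \<epsilon>" by blast
qed

lemma AC_on_imp_continuous_on: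
  assumes ac: "AC_on a b f"
  shows "continuous_on {a..b} f"
  unfolding continuous_on_iff
proof (intro ballI allI impI)
  fix x and e :: real assume x: "x \<in> {a..b}" and "e > 0"
  then obtain \<delta> where "\<delta> > 0"
    and d: "\<And>P. interval_system a b P \<Longrightarrow> total_length P < \<delta> \<Longrightarrow> variation f P < e"
    using ac[unfolded AC_on_def] by meson
  have *: "\<bar>f v - f u\<bar> < e" if "a \<le> u" "u < v" "v \<le> b" "v - u < \<delta>" for u v
  proof -
    have "interval_system a b {(u, v)}" using that by (auto simp: interval_system_def)
    then show ?thesis using d[of "{(u, v)}"] that by (simp add: total_length_def variation_def)
  qed
  have "dist (f x') (f x) < e" if "x' \<in> {a..b}" "dist x' x < \<delta>" for x'
    using *[of x x'] *[of x' x] x that \<open>e > 0\<close> by (cases x x' rule: linorder_cases) (auto simp: dist_real_def)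
  with \<open>\<delta> > 0\<close> show "\<exists>d>0. \<forall>x'\<in>{a..b}. dist x' x < d \<longrightarrow> dist (f x') (f x) < e" by blast
qed

section \<open>Densities of absolutely continuous functions\<close>

text \<open>The hypothesis speaks of finite systems, whereas an open set is a countable union of
  intervals. Continuity from below reduces the claim to finite unions of closed intervals, and these
  are divided into systems.\<close>

lemma emeasure_interval_measure_le_of_open:
  fixes F :: "real \<Rightarrow> real"
  assumes mono: "mono F" and cont: "continuous_on UNIV F"
    and V: "open V" "V \<subseteq> {a..b}" "emeasure lborel V < ennreal \<delta>"
    and var: "\<And>P. interval_system a b P \<Longrightarrow> total_length P < \<delta> \<Longrightarrow> variation F P \<le> \<epsilon>"
  shows "emeasure (interval_measure F) V \<le> ennreal \<epsilon>"
proof -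
  let ?\<mu> = "interval_measure F"
  obtain D where D: "countable D" "D \<subseteq> Pow V" "\<And>X. X \<in> D \<Longrightarrow> \<exists>u v. X = cbox u v" "\<Union>D = V"
    using open_countable_Union_open_cbox[OF V(1)] by blast
  \<comment> \<open>The inserted empty set keeps the family nonempty, so that
    \<open>from_nat_into\<close> enumerates exactly this family even when \<open>V\<close> is
    empty.\<close>
  define X where "X = from_nat_into (insert {} D)"
  have rX: "range X = insert {} D"
    unfolding X_def using D(1) by (intro range_from_nat_into) auto
  have Xbox: "\<exists>u v. X i = cbox u v" for i
  proof (cases "X i = {}")
    case True
    then show ?thesis by (intro exI[of _ 1] exI[of _ 0]) simp
  next
    case False
    then show ?thesis using rX D(3)[of "X i"] rangeI[of X i] by auto
  qed
  define A where "A = (\<lambda>n. \<Union>i<n. X i)"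
  have "(\<Union>n. A n) = \<Union>(range X)" by (auto simp: A_def)
  then have UA: "(\<Union>n. A n) = V" using rX D(4) by simp
  moreover have "incseq A" by (auto simp: A_def incseq_def intro: less_le_trans)
  moreover have "A n \<in> sets ?\<mu>" for n
  proof -
    have "X i \<in> sets borel" for i using Xbox[of i] by auto
    then show ?thesis by (simp add: A_def)
  qed
  ultimately have "emeasure ?\<mu> V = (SUP n. emeasure ?\<mu> (A n))"
    using SUP_emeasure_incseq[of A ?\<mu>] by (metis image_subsetI)
  also have "\<dots> \<le> ennreal \<epsilon>"
  proof (rule SUP_least)
    fix n :: nat
    \<comment> \<open>The boxes may overlap; a division replaces them by closed intervals with
      disjoint interiors.\<close>
    obtain p where "p division_of \<Union>(X ` {..<n})"
      using elementary_unions_intervals[of "X ` {..<n}"] Xbox by blast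
    then have p: "p division_of A n" by (simp add: A_def)
    have AV: "A n \<subseteq> V" using UA by blast
    have Kall: "K = {Inf K..Sup K} \<and> Inf K \<le> Sup K \<and> {Inf K..Sup K} \<subseteq> V" if K: "K \<in> p" for K
    proof -
      obtain u v where "K = cbox u v" using division_ofD(4)[OF p K] by blast
      moreover have "K \<noteq> {}" "K \<subseteq> A n" using division_ofD(2,3)[OF p K] by auto
      ultimately show ?thesis using AV by auto
    qed
    have Kle: "Inf K \<le> Sup K" and Ksub: "{Inf K..Sup K} \<subseteq> V" if "K \<in> p" for K
      using Kall[OF that] by blast+
    have Kint: "interior K = {Inf K<..<Sup K}" if "K \<in> p" for K
      using Kall[OF that] interior_atLeastAtMost_real by metis
    have Kborel: "K \<in> sets borel" if "K \<in> p" for K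
      using Kall[OF that] borel_closed[OF closed_atLeastAtMost] by metis
    \<comment> \<open>A continuous \<open>F\<close> gives its measure no atoms, so a closed interval
      has just the increment of \<open>F\<close> as its mass.\<close>
    have Kmeas: "emeasure ?\<mu> K = ennreal (F (Sup K) - F (Inf K))" if "K \<in> p" for K
      using Kall[OF that] emeasure_interval_measure_Icc[OF Kle[OF that] monoD[OF mono] cont] by metis
    \<comment> \<open>Divisions may contain single points, which \<open>interval_system\<close>
      excludes. Dropping them costs nothing because \<open>F\<close> has increment 0 there.\<close>
    define p' where "p' = {K\<in>p. Inf K < Sup K}"
    define P where "P = (\<lambda>K. (Inf K, Sup K)) ` p'"
    have finp: "finite p" using p by (rule division_of_finite)
    have inj: "inj_on (\<lambda>K. (Inf K, Sup K)) p'"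
    proof (rule inj_onI)
      fix C E assume *: "C \<in> p'" "E \<in> p'" "(Inf C, Sup C) = (Inf E, Sup E)"
      then have "C = {Inf C..Sup C}" "E = {Inf E..Sup E}"
        unfolding p'_def using Kall by blast+
      moreover have "{Inf C..Sup C} = {Inf E..Sup E}" using *(3) by simp
      ultimately show "C = E" by argo
    qed
    have sysP: "interval_system a b P"
    proof (rule interval_systemI)
      show "finite P" using finp by (simp add: P_def p'_def)
      show "a \<le> u \<and> u < v \<and> v \<le> b" if uv: "(u, v) \<in> P" for u v
      proof -
        obtain C where C: "C \<in> p" "u = Inf C" "v = Sup C" "u < v" using uv by (auto simp: P_def p'_def)
        then have "{u..v} \<subseteq> {a..b}" using subset_trans[OF Ksub[OF C(1)] V(2)] by simp
        then show ?thesis using \<open>u < v\<close> by auto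
      qed
      fix q r x assume q: "q \<in> P" and r: "r \<in> P" and x: "x \<in> {fst q<..<snd q}" "x \<in> {fst r<..<snd r}"
      obtain C where C: "C \<in> p" "q = (Inf C, Sup C)" using q by (auto simp: P_def p'_def)
      obtain E where E: "E \<in> p" "r = (Inf E, Sup E)" using r by (auto simp: P_def p'_def)
      have "interior C = {fst q<..<snd q}" "interior E = {fst r<..<snd r}"
        using Kint[OF C(1)] Kint[OF E(1)] C(2) E(2) by simp_all
      then have "C = E" using division_ofD(5)[OF p C(1) E(1)] x by blast
      then show "q = r" using C E by simp
    qed
    \<comment> \<open>Only an inequality is claimed, since \<open>measure\<close> would send an
      infinite \<open>emeasure\<close> to 0.\<close>
    have "ennreal (total_length P) \<le> emeasure lborel (\<Union>p\<in>P. {fst p<..<snd p})"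
      unfolding total_length_eq_measure[OF sysP] measure_def by (simp add: ennreal_enn2real_if)
    also have "\<dots> \<le> emeasure lborel V"
    proof (rule emeasure_mono)
      show "(\<Union>p\<in>P. {fst p<..<snd p}) \<subseteq> V"
      proof
        fix x assume "x \<in> (\<Union>p\<in>P. {fst p<..<snd p})"
        then obtain C where "C \<in> p" "x \<in> {Inf C<..<Sup C}" by (auto simp: P_def p'_def)
        then show "x \<in> V" using Ksub[of C] by auto
      qed
    qed (use V(1) in auto)
    also have "\<dots> < ennreal \<delta>" by fact
    finally have "total_length P < \<delta>"
      by (metis ennreal_leI not_less)
    then have le: "variation F P \<le> \<epsilon>" by (rule var[OF sysP])
    have "emeasure ?\<mu> (A n) = emeasure ?\<mu> (\<Union>K\<in>p. K)"
      using division_ofD(6)[OF p] by simp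
    also have "\<dots> \<le> (\<Sum>K\<in>p. emeasure ?\<mu> K)"
    proof (rule emeasure_subadditive_finite[OF finp])
      show "(\<lambda>K. K) ` p \<subseteq> sets ?\<mu>"
        using Kborel by auto
    qed
    also have "\<dots> = (\<Sum>K\<in>p. ennreal (F (Sup K) - F (Inf K)))"
      using Kmeas by (intro sum.cong) auto
    also have "\<dots> = ennreal (\<Sum>K\<in>p. F (Sup K) - F (Inf K))"
      using Kle monoD[OF mono] by (intro sum_ennreal) simp
    also have "(\<Sum>K\<in>p. F (Sup K) - F (Inf K)) = (\<Sum>K\<in>p'. F (Sup K) - F (Inf K))"
      unfolding p'_def using Kle by (intro sum.mono_neutral_right finp) (auto, metis antisym not_less)
    also have "\<dots> = (\<Sum>K\<in>p'. \<bar>F (Sup K) - F (Inf K)\<bar>)"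
      unfolding p'_def using monoD[OF mono] by (intro sum.cong) (auto simp: less_imp_le)
    also have "\<dots> = variation F P"
      by (simp add: variation_def P_def case_prod_unfold sum.reindex[OF inj])
    also have "ennreal (variation F P) \<le> ennreal \<epsilon>" using le by (rule ennreal_leI)
    finally show "emeasure ?\<mu> (A n) \<le> ennreal \<epsilon>" .
  qed
  finally show ?thesis .
qed

text \<open>By outer regularity a null set sits in open sets of arbitrarily small length, to which
  the previous lemma applies with arbitrarily small \<epsilon>.\<close>

lemma AC_on_interval_measure_null:
  fixes F :: "real \<Rightarrow> real"
  assumes mono: "mono F" and cont: "continuous_on UNIV F" and ac: "AC_on a b F"
    and N: "N \<in> null_sets lborel"
  shows "emeasure (interval_measure F) (N \<inter> {a<..b}) = 0"
proof -
  let ?\<mu> = "interval_measure F"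
  have Nb: "N \<in> sets borel" using N by (simp add: null_sets_def)
  \<comment> \<open>The open interval comes first, because the covering set must be open and lie
    within \<open>{a..b}\<close>. The summand \<open>0\<close> gives the shape expected by
    \<open>ennreal_le_epsilon\<close>.\<close>
  have "emeasure ?\<mu> (N \<inter> {a<..<b}) \<le> 0 + ennreal \<epsilon>" if eps: "\<epsilon> > 0" for \<epsilon>
  proof -
    obtain \<delta> where "\<delta> > 0"
      and d: "\<And>P. interval_system a b P \<Longrightarrow> total_length P < \<delta> \<Longrightarrow> variation F P < \<epsilon>"
      using ac[unfolded AC_on_def] eps by meson
    obtain U where U: "open U" "N \<subseteq> U" "emeasure lborel (U - N) < \<delta>"
      using outer_regular_lborel[OF Nb \<open>\<delta> > 0\<close>] by blast
    have "emeasure lborel (U \<inter> {a<..<b}) \<le> emeasure lborel U"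
      using U(1) by (intro emeasure_mono) auto
    also have "\<dots> = emeasure lborel (U - N)"
      using N U(1) by (simp add: emeasure_Diff_null_set)
    also have "\<dots> < \<delta>" by fact
    finally have "emeasure ?\<mu> (U \<inter> {a<..<b}) \<le> ennreal \<epsilon>"
      using U(1) d by (intro emeasure_interval_measure_le_of_open[OF mono cont, of _ a b \<delta>]) (auto intro: less_imp_le)
    moreover have "emeasure ?\<mu> (N \<inter> {a<..<b}) \<le> emeasure ?\<mu> (U \<inter> {a<..<b})"
      using U by (intro emeasure_mono) auto
    ultimately show ?thesis by simp
  qed
  then have "emeasure ?\<mu> (N \<inter> {a<..<b}) \<le> 0" by (rule ennreal_le_epsilon)
  \<comment> \<open>The right endpoint is added back as a single point without mass.\<close>
  moreover have "emeasure ?\<mu> {b} = 0"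
    using emeasure_interval_measure_Icc[OF _ monoD[OF mono] cont, of b b] by simp
  moreover have "emeasure ?\<mu> (N \<inter> {a<..b}) \<le> emeasure ?\<mu> ((N \<inter> {a<..<b}) \<union> {b})"
    using Nb by (intro emeasure_mono) auto
  moreover have "\<dots> \<le> emeasure ?\<mu> (N \<inter> {a<..<b}) + emeasure ?\<mu> {b}"
    using Nb by (intro emeasure_subadditive) auto
  ultimately show ?thesis by simp
qed

section \<open>Radon-Nikodym densities\<close>

lemma AC_on_cong:
  assumes "AC_on a b f" "\<And>x. x \<in> {a..b} \<Longrightarrow> f x = g x"
  shows "AC_on a b g"
proof -
  have "variation g P = variation f P" if P: "interval_system a b P" for P
    unfolding variation_def
  proof (rule sum.cong[OF refl])
    fix p assume "p \<in> P"
    then show "(case p of (u, v) \<Rightarrow> \<bar>g v - g u\<bar>) = (case p of (u, v) \<Rightarrow> \<bar>f v - f u\<bar>)"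
      using interval_system_memD[OF P, of "fst p" "snd p"] assms(2)[of "fst p"] assms(2)[of "snd p"]
      by (simp add: case_prod_unfold)
  qed
  then show ?thesis using assms(1) unfolding AC_on_def by metis
qed

text \<open>The Stieltjes measure of \<open>F\<close> is absolutely continuous with respect to
  Lebesgue measure, and its Radon-Nikodym density is the required integrand.\<close>

lemma mono_AC_on_density:
  fixes F :: "real \<Rightarrow> real"
  assumes "a < b" and mono: "mono_on {a..b} F" and ac: "AC_on a b F"
  obtains g where "integrable lborel g"
    "\<And>x. x \<in> {a..b} \<Longrightarrow> (LINT t:{a..x}|lborel. g t) = F x - F a"
proof -
  \<comment> \<open>\<open>interval_measure\<close> wants a function that is monotone and
    right-continuous on the whole line; clamping the argument extends \<open>F\<close> by
    constants.\<close>
  define G where "G = (\<lambda>x. F (max a (min b x)))"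
  have GF: "G x = F x" if "x \<in> {a..b}" for x using that by (simp add: G_def)
  have Gm: "mono G"
    unfolding G_def using \<open>a < b\<close> by (intro monoI mono_onD[OF mono]) auto
  have Gc: "continuous_on UNIV G"
    unfolding G_def using \<open>a < b\<close>
    by (intro continuous_on_compose2[OF AC_on_imp_continuous_on[OF ac]] continuous_intros) auto
  have rc: "continuous (at_right x) G" for x
    using Gc by (simp add: continuous_on_eq_continuous_within continuous_at_imp_continuous_at_within)
  have Ga: "AC_on a b G" using AC_on_cong[OF ac] GF by metis
  let ?\<mu> = "interval_measure G"
  define N where "N = density ?\<mu> (indicator {a<..b})"
  have setsN: "sets N = sets lborel" by (simp add: N_def)
  have N: "emeasure N A = emeasure ?\<mu> (A \<inter> {a<..b})" if "A \<in> sets borel" for A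
    unfolding N_def using that by (subst emeasure_density) (auto simp: nn_integral_indicator[symmetric] indicator_inter_arith Int_commute mult.commute simp del: nn_integral_indicator)
  have "absolutely_continuous lborel N"
    unfolding absolutely_continuous_def
    using N AC_on_interval_measure_null[OF Gm Gc Ga] setsN by (auto simp: null_sets_def)
  then obtain f where f: "f \<in> borel_measurable lborel" "density lborel f = N"
    using sigma_finite_measure.Radon_Nikodym[OF sigma_finite_lborel] setsN by blast
  have f_int: "(\<integral>\<^sup>+t. f t * indicator {a..x} t \<partial>lborel) = ennreal (F x - F a)" if x: "x \<in> {a..b}" for x
  proof -
    have "(\<integral>\<^sup>+t. f t * indicator {a..x} t \<partial>lborel) = emeasure N {a..x}"
      using f by (subst f(2)[symmetric], subst emeasure_density) auto
    also have "\<dots> = emeasure ?\<mu> {a<..x}"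
      using x by (subst N) (auto intro!: arg_cong[where f="emeasure ?\<mu>"])
    also have "\<dots> = ennreal (G x - G a)"
      using x by (intro emeasure_interval_measure_Ioc monoD[OF Gm] rc) auto
    finally show ?thesis using x GF by simp
  qed
  \<comment> \<open>The density is extended-valued, but its finite integral over
    \<open>{a..b}\<close> makes it finite almost everywhere there. Passing to real values thus
    changes no integral.\<close>
  define g where "g = (\<lambda>t. enn2real (f t * indicator {a..b} t))"
  have "AE t in lborel. f t * indicator {a..b} t \<noteq> \<infinity>"
    using f_int[of b] f(1) \<open>a < b\<close> by (intro nn_integral_PInf_AE) auto
  then have fin: "AE t in lborel. ennreal (g t) = f t * indicator {a..b} t"
    by eventually_elim (simp add: g_def less_top)
  have gm: "g \<in> borel_measurable lborel" using f(1) by (simp add: g_def)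
  have gx: "(\<integral>\<^sup>+t. ennreal (g t * indicator {a..x} t) \<partial>lborel) = ennreal (F x - F a)" if x: "x \<in> {a..b}" for x
  proof -
    have "(\<integral>\<^sup>+t. ennreal (g t * indicator {a..x} t) \<partial>lborel) = (\<integral>\<^sup>+t. f t * indicator {a..x} t \<partial>lborel)"
      by (rule nn_integral_cong_AE, use fin in eventually_elim) (use x in \<open>auto simp: indicator_def\<close>)
    then show ?thesis using f_int[OF x] by simp
  qed
  have g0: "g t \<ge> 0" for t by (simp add: g_def)
  have gi: "g t * indicator {a..b} t = g t" for t by (simp add: g_def indicator_def)
  have "(\<integral>\<^sup>+t. ennreal (g t) \<partial>lborel) < \<infinity>"
    using gx[of b, unfolded gi] \<open>a < b\<close> by simp
  then have "integrable lborel g"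
    using gm g0 by (intro integrableI_nonneg) auto
  moreover have "(LINT t:{a..x}|lborel. g t) = F x - F a" if x: "x \<in> {a..b}" for x
  proof -
    have "(LINT t:{a..x}|lborel. g t) = (\<integral>t. g t * indicator {a..x} t \<partial>lborel)"
      by (simp add: set_lebesgue_integral_def mult.commute)
    also have "\<dots> = enn2real (ennreal (F x - F a))"
      unfolding gx[OF x, symmetric] using gm g0 by (intro integral_eq_nn_integral) (auto simp: gm)
    also have "\<dots> = F x - F a"
      using mono_onD[OF mono, of a x] x by simp
    finally show ?thesis .
  qed
  ultimately show ?thesis using that by blast
qed

text \<open>Jordan decomposition: \<open>f\<close> is its total variation minus the difference of
  the total variation and \<open>f\<close>. Both are nondecreasing and absolutely continuous, so
  their densities subtract.\<close>

lemma AC_on_density: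
  assumes "a < b" and ac: "AC_on a b f"
  obtains g where "integrable lborel g"
    "\<And>x. x \<in> {a..b} \<Longrightarrow> (LINT t:{a..x}|lborel. g t) = f x - f a"
proof -
  let ?T = "total_variation f a"
  have inc: "?T c + \<bar>f d - f c\<bar> \<le> ?T d" if "a \<le> c" "c \<le> d" "d \<le> b" for c d
    using total_variation_increment[OF ac that] .
  have m: "mono_on {a..b} ?T" "mono_on {a..b} (\<lambda>x. ?T x - f x)"
    by (intro mono_onI, use inc in \<open>force simp: abs_le_iff\<close>)+
  obtain g1 where g1: "integrable lborel g1"
    "\<And>x. x \<in> {a..b} \<Longrightarrow> (LINT t:{a..x}|lborel. g1 t) = ?T x - ?T a"
    using mono_AC_on_density[OF \<open>a < b\<close> m(1) AC_on_total_variation[OF ac]] by blast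
  obtain g2 where g2: "integrable lborel g2"
    "\<And>x. x \<in> {a..b} \<Longrightarrow> (LINT t:{a..x}|lborel. g2 t) = (?T x - f x) - (?T a - f a)"
    using mono_AC_on_density[OF \<open>a < b\<close> m(2) AC_on_diff[OF AC_on_total_variation[OF ac] ac]] by blast
  have "set_integrable lborel {a..x} g1" "set_integrable lborel {a..x} g2" for x
    unfolding set_integrable_def by (rule integrable_mult_indicator[OF _ g1(1)], simp)
      (rule integrable_mult_indicator[OF _ g2(1)], simp)
  then have "(LINT t:{a..x}|lborel. g1 t - g2 t) = f x - f a" if "x \<in> {a..b}" for x
    using g1(2)[OF that] g2(2)[OF that] by (simp add: set_integral_diff)
  then show ?thesis using that[of "\<lambda>t. g1 t - g2 t"] g1(1) g2(1) by simp
qed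

section \<open>The fundamental theorem of calculus\<close>

text \<open>\<open>integrable_ccontinuous_explicit\<close> yields only limits of averages over
  intervals to the right of a point. Applied also to the reflected function, it gives the left
  limits, with an exceptional set that is reflected back.\<close>

lemma lebesgue_differentiation_real:
  fixes g :: "real \<Rightarrow> real"
  assumes g: "\<And>u v. g integrable_on {u..v}"
  obtains N where "negligible N"
    "\<And>x. \<lbrakk>x \<notin> N; a < x\<rbrakk> \<Longrightarrow> ((\<lambda>x. integral {a..x} g) has_real_derivative g x) (at x)"
proof -
  define g' where "g' = (\<lambda>x. g (- x))"
  have g': "g' integrable_on {u..v}" for u v
    using g[of "- v" "- u"] Henstock_Kurzweil_Integration.integrable_reflect_real[where f = g and a = "- v" and b = "- u"] by (simp add: g'_def)
  obtain N1 where N1: "negligible N1"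
    "\<And>x e. \<lbrakk>x \<notin> N1; 0 < e\<rbrakk> \<Longrightarrow> \<exists>d>0. \<forall>h. 0 < h \<and> h < d \<longrightarrow> \<bar>integral {x..x + h} g / h - g x\<bar> < e"
    using integrable_ccontinuous_explicit[of g] g by (auto simp: divide_inverse mult.commute)
  obtain N2 where N2: "negligible N2"
    "\<And>x e. \<lbrakk>x \<notin> N2; 0 < e\<rbrakk> \<Longrightarrow> \<exists>d>0. \<forall>h. 0 < h \<and> h < d \<longrightarrow> \<bar>integral {x..x + h} g' / h - g' x\<bar> < e"
    using integrable_ccontinuous_explicit[of g'] g' by (auto simp: divide_inverse mult.commute)
  define N where "N = N1 \<union> uminus ` N2"
  have "negligible N"
    unfolding N_def using N1(1) N2(1)
    by (intro negligible_Un negligible_differentiable_image_negligible) (auto intro!: derivative_intros)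
  moreover have "((\<lambda>x. integral {a..x} g) has_real_derivative g x) (at x)" if "x \<notin> N" "a < x" for x
    unfolding DERIV_def LIM_eq
  proof (intro allI impI)
    fix e :: real assume "e > 0"
    have "x \<notin> N1" "- x \<notin> N2" using \<open>x \<notin> N\<close> by (force simp: N_def)+
    obtain d1 where d1: "d1 > 0" "\<And>h. 0 < h \<Longrightarrow> h < d1 \<Longrightarrow> \<bar>integral {x..x + h} g / h - g x\<bar> < e"
      using N1(2)[OF \<open>x \<notin> N1\<close> \<open>e > 0\<close>] by blast
    obtain d2 where d2: "d2 > 0" "\<And>h. 0 < h \<Longrightarrow> h < d2 \<Longrightarrow> \<bar>integral {- x..- x + h} g' / h - g' (- x)\<bar> < e"
      using N2(2)[OF \<open>- x \<notin> N2\<close> \<open>e > 0\<close>] by blast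
    \<comment> \<open>The bound \<open>x - a\<close> keeps \<open>x - k\<close> to the right of
      \<open>a\<close>, so that the integral from \<open>a\<close> can be split there.\<close>
    define s where "s = min (min d1 d2) (x - a)"
    have "s > 0" using d1 d2 \<open>a < x\<close> by (simp add: s_def)
    moreover have "norm ((integral {a..x + h} g - integral {a..x} g) / h - g x) < e"
      if h: "h \<noteq> 0" "norm (h - 0) < s" for h
    proof (cases "h > 0")
      case True
      have "integral {a..x} g + integral {x..x + h} g = integral {a..x + h} g"
        using True \<open>a < x\<close> g by (intro Henstock_Kurzweil_Integration.integral_combine) auto
      then have "integral {a..x + h} g - integral {a..x} g = integral {x..x + h} g" by simp
      then show ?thesis using d1(2)[of h] True h by (simp add: s_def)
    next
      case False
      define k where "k = - h"
      have k: "0 < k" "k < s" "h = - k" using False h by (auto simp: k_def)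
      have "integral {a..x - k} g + integral {x - k..x} g = integral {a..x} g"
        using k \<open>a < x\<close> g by (intro Henstock_Kurzweil_Integration.integral_combine) (auto simp: s_def)
      then have "integral {a..x} g - integral {a..x - k} g = integral {x - k..x} g" by simp
      moreover have "integral {- x..- x + k} g' = integral {x - k..x} g"
        using Henstock_Kurzweil_Integration.integral_reflect_real[where f = g and a = "x - k" and b = x] by (simp add: g'_def)
      ultimately have "(integral {a..x + h} g - integral {a..x} g) / h = integral {- x..- x + k} g' / k"
        using k by (simp add: minus_divide_left)
      then show ?thesis using d2(2)[of k] k by (simp add: s_def g'_def)
    qed
    ultimately show "\<exists>s>0. \<forall>h. h \<noteq> 0 \<and> norm (h - 0) < s \<longrightarrow>
        norm ((integral {a..x + h} g - integral {a..x} g) / h - g x) < e" by blast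
  qed
  ultimately show ?thesis using that by blast
qed

text \<open>Up to a constant, \<open>f\<close> is the indefinite integral of a density
  \<open>g\<close>. Differentiating almost everywhere identifies \<open>deriv f\<close> with
  \<open>g\<close>, which transfers integrability and integrals.\<close>

lemma abs_continuous_fundamental_theorem:
  assumes "a < b" and f: "abs_continuous_on_interval a b f"
  shows "set_integrable lebesgue {a..b} (deriv f)"
    and "\<And>x. x \<in> {a..b} \<Longrightarrow> (LINT t:{a..x}|lebesgue. deriv f t) = f x - f a"
proof -
  obtain g where g: "integrable lborel g"
    and fg: "\<And>x. x \<in> {a..b} \<Longrightarrow> (LINT t:{a..x}|lborel. g t) = f x - f a"
    using AC_on_density[OF \<open>a < b\<close> abs_continuous_imp_AC_on[OF f]] by blast
  have gl: "set_integrable lborel {u..v} g" for u v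
    unfolding set_integrable_def by (rule integrable_mult_indicator[OF _ g]) simp
  have gL: "set_integrable lebesgue {u..v} g" for u v
    using gl[of u v] unfolding set_integrable_def
    by (subst integrable_completion) (auto simp: integrable_iff_bounded)
  note gi = set_borel_integral_eq_integral[OF gl]
  have f_eq: "f x = f a + integral {a..x} g" if "x \<in> {a..b}" for x
    using fg[OF that] gi(2)[of a x] by simp
  obtain N where N: "negligible N"
    "\<And>x. \<lbrakk>x \<notin> N; a < x\<rbrakk> \<Longrightarrow> ((\<lambda>x. integral {a..x} g) has_real_derivative g x) (at x)"
    using lebesgue_differentiation_real[of g a] gi(1) by blast
  \<comment> \<open>The formula for \<open>f\<close> is known only on \<open>{a..b}\<close>, while
    \<open>deriv\<close> is two-sided; interior points have the neighbourhood needed to transfer the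
    derivative.\<close>
  have deriv: "deriv f x = g x" if "x \<in> {a<..<b} - N" for x
  proof (rule DERIV_imp_deriv, rule has_field_derivative_transform_within_open)
    show "((\<lambda>x. f a + integral {a..x} g) has_real_derivative g x) (at x)"
      using DERIV_add[OF DERIV_const[of "f a"] N(2)[of x]] that by simp
    show "f a + integral {a..t} g = f t" if "t \<in> {a<..<b}" for t
      using f_eq[of t] that by simp
  qed (use that in auto)
  \<comment> \<open>At the endpoints \<open>deriv f\<close> depends on values outside the interval,
    so they join the exceptional set.\<close>
  define N' where "N' = insert a (insert b N)"
  have N': "negligible N'" using N(1) by (simp add: N'_def)
  have dg: "deriv f x = g x" if "x \<in> {a..c} - N'" "c \<le> b" for x c
    using deriv[of x] that by (auto simp: N'_def)
  have int: "set_integrable lebesgue {a..c} (deriv f)" if "c \<le> b" for c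
    using absolutely_integrable_spike[OF gL N'] dg that by blast
  then show "set_integrable lebesgue {a..b} (deriv f)" by simp
  show "(LINT t:{a..x}|lebesgue. deriv f t) = f x - f a" if x: "x \<in> {a..b}" for x
  proof -
    have "(LINT t:{a..x}|lebesgue. deriv f t) = integral {a..x} (deriv f)"
      using set_lebesgue_integral_eq_integral(2)[OF int] x by simp
    also have "\<dots> = integral {a..x} g"
      by (rule integral_spike[OF N']) (use dg x in auto)
    finally show ?thesis using f_eq[OF x] by simp
  qed
qed

section \<open>Fractional integration by parts\<close>

text \<open>Needed to apply Fubini to the completed measure used by the operators; the cover by sets
  of finite measure is inherited from \<open>lborel\<close>.\<close>

lemma sigma_finite_lebesgue: "sigma_finite_measure (lebesgue :: 'a::euclidean_space measure)"
proof
  obtain A :: "'a set set" where "countable A" "A \<subseteq> sets lborel" "\<Union>A = space lborel"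
    "\<forall>a\<in>A. emeasure lborel a \<noteq> \<infinity>"
    using lborel.sigma_finite_countable by blast
  then show "\<exists>A. countable A \<and> A \<subseteq> sets (lebesgue :: 'a measure) \<and> \<Union>A = space lebesgue \<and>
      (\<forall>a\<in>A. emeasure lebesgue a \<noteq> \<infinity>)"
    by (intro exI[of _ A]) (auto simp: subset_iff)
qed

section \<open>The weakly singular kernel and Fubini's theorem\<close>

lemma has_integral_right_kernel:
  fixes \<gamma> t c :: real
  assumes "0 < \<gamma>" "t \<le> c"
  shows "((\<lambda>x. (x - t) powr (\<gamma> - 1)) has_integral (c - t) powr \<gamma> / \<gamma>) {t..c}"
proof -
  have "((\<lambda>x. x powr (\<gamma> - 1)) has_integral (c - t) powr \<gamma> / \<gamma>) (cbox 0 (c - t))"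
    using has_integral_powr_from_0[of "\<gamma> - 1" "c - t"] assms by simp
  from has_integral_affinity[OF this, of 1 "- t"] show ?thesis
    by (simp add: add.commute[of _ t])
qed

lemma right_kernel_integrable:
  fixes \<gamma> t c :: real
  assumes "0 < \<gamma>" "t \<le> c"
  shows "set_integrable lebesgue {t..c} (\<lambda>x. (x - t) powr (\<gamma> - 1))"
    and "(LINT x:{t..c}|lebesgue. (x - t) powr (\<gamma> - 1)) = (c - t) powr \<gamma> / \<gamma>"
proof -
  show *: "set_integrable lebesgue {t..c} (\<lambda>x. (x - t) powr (\<gamma> - 1))"
    using has_integral_right_kernel[OF assms] by (intro nonnegative_absolutely_integrable_1) auto
  show "(LINT x:{t..c}|lebesgue. (x - t) powr (\<gamma> - 1)) = (c - t) powr \<gamma> / \<gamma>"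
    using set_lebesgue_integral_eq_integral(2)[OF *] has_integral_right_kernel[OF assms]
    by (simp add: integral_unique)
qed

text \<open>The bound does not depend on \<open>t\<close>. It provides the majorant for Fubini and
  later bounds the fractional integral in the Euler--Lagrange equation.\<close>

lemma right_kernel_bounded:
  fixes \<gamma> a b t M :: real and p :: "real \<Rightarrow> real"
  assumes "0 < \<gamma>" and t: "t \<in> {a..b}"
    and p: "set_borel_measurable lebesgue {a..b} p" and M: "\<And>x. x \<in> {a..b} \<Longrightarrow> \<bar>p x\<bar> \<le> M"
  shows "set_integrable lebesgue {t..b} (\<lambda>x. (x - t) powr (\<gamma> - 1) * p x)"
    and "\<bar>LINT x:{t..b}|lebesgue. (x - t) powr (\<gamma> - 1) * p x\<bar> \<le> M * ((b - a) powr \<gamma> / \<gamma>)"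
proof -
  have M0: "0 \<le> M" using M[OF t] by linarith
  have [measurable]: "(\<lambda>x::real. x) \<in> borel_measurable lebesgue" by (rule measurable_completion) simp
  have pm: "set_borel_measurable lebesgue {t..b} p"
    using t by (intro set_borel_measurable_subset[OF p]) auto
  have K: "set_integrable lebesgue {t..b} (\<lambda>x. M * (x - t) powr (\<gamma> - 1))"
    using right_kernel_integrable(1)[OF \<open>0 < \<gamma>\<close>, of t b] t by simp
  have [measurable]: "(\<lambda>x. indicator {t..b} x * p x) \<in> borel_measurable lebesgue"
    using pm by (simp add: set_borel_measurable_def)
  have "(\<lambda>x. (x - t) powr (\<gamma> - 1) * (indicator {t..b} x * p x)) \<in> borel_measurable lebesgue"
    by measurable
  then have meas: "set_borel_measurable lebesgue {t..b} (\<lambda>x. (x - t) powr (\<gamma> - 1) * p x)"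
    by (simp add: set_borel_measurable_def mult.left_commute)
  have le: "norm ((x - t) powr (\<gamma> - 1) * p x) \<le> M * (x - t) powr (\<gamma> - 1)" if "x \<in> {t..b}" for x
    using M[of x] that t by (simp add: abs_mult mult.commute mult_right_mono)
  show int: "set_integrable lebesgue {t..b} (\<lambda>x. (x - t) powr (\<gamma> - 1) * p x)"
    by (rule set_integrable_bound[OF K meas]) (use le M0 in \<open>auto simp: abs_mult\<close>)
  have "\<bar>LINT x:{t..b}|lebesgue. (x - t) powr (\<gamma> - 1) * p x\<bar>
      \<le> (LINT x:{t..b}|lebesgue. M * (x - t) powr (\<gamma> - 1))"
    unfolding set_lebesgue_integral_def real_norm_def[symmetric]
    using int K le unfolding set_integrable_def
    by (intro Bochner_Integration.integral_norm_bound_integral) (auto simp: indicator_def)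
  also have "\<dots> = M * ((b - t) powr \<gamma> / \<gamma>)"
    using right_kernel_integrable(2)[OF \<open>0 < \<gamma>\<close>, of t b] t by simp
  also have "\<dots> \<le> M * ((b - a) powr \<gamma> / \<gamma>)"
    using t \<open>0 < \<gamma>\<close> M0 by (intro mult_left_mono divide_right_mono powr_mono2) auto
  finally show "\<bar>LINT x:{t..b}|lebesgue. (x - t) powr (\<gamma> - 1) * p x\<bar> \<le> M * ((b - a) powr \<gamma> / \<gamma>)" .
qed

text \<open>Both sides are iterated integrals over the triangle a \<le> t \<le> x \<le> b. The inner
  integral over \<open>x\<close> of the absolute value is at most a constant times the absolute
  value of \<open>f\<close>, which justifies the interchange.\<close>

lemma RL_integration_by_parts:
  fixes \<gamma> a b M :: real and f p :: "real \<Rightarrow> real"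
  assumes "0 < \<gamma>" and f: "set_integrable lebesgue {a..b} f"
    and p: "set_borel_measurable lebesgue {a..b} p" and M: "\<And>x. x \<in> {a..b} \<Longrightarrow> \<bar>p x\<bar> \<le> M"
  shows "set_integrable lebesgue {a..b} (\<lambda>x. p x * left_RL_integral a \<gamma> f x)"
    and "set_integrable lebesgue {a..b} (\<lambda>t. f t * right_RL_integral b \<gamma> p t)"
    and "(LINT x:{a..b}|lebesgue. p x * left_RL_integral a \<gamma> f x) =
         (LINT t:{a..b}|lebesgue. f t * right_RL_integral b \<gamma> p t)"
proof -
  interpret sigma_finite_measure "lebesgue :: real measure" by (rule sigma_finite_lebesgue)
  interpret P: pair_sigma_finite "lebesgue :: real measure" "lebesgue :: real measure" ..
  define f' where "f' = (\<lambda>t. indicator {a..b} t *\<^sub>R f t)"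
  define p' where "p' = (\<lambda>x. indicator {a..b} x *\<^sub>R p x)"
  \<comment> \<open>The cutoff encodes the triangle, so both iterated integrals can run over the
    whole line; \<open>f'\<close> and \<open>p'\<close> vanish off \<open>{a..b}\<close>.\<close>
  define k where "k = (\<lambda>t x. if t \<le> x then (x - t) powr (\<gamma> - 1) else (0::real))"
  define H where "H = (\<lambda>t x. f' t * (p' x * k t x))"
  have f'_int: "integrable lebesgue f'" using f by (simp add: f'_def set_integrable_def)
  then have [measurable]: "f' \<in> borel_measurable lebesgue" by simp
  have [measurable]: "p' \<in> borel_measurable lebesgue" using p by (simp add: p'_def set_borel_measurable_def)
  have id: "(\<lambda>x::real. x) \<in> borel_measurable lebesgue" by (rule measurable_completion) simp
  have [measurable]: "fst \<in> borel_measurable ((lebesgue :: real measure) \<Otimes>\<^sub>M (lebesgue :: real measure))"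
    by (rule measurable_compose[OF measurable_fst id])
  have [measurable]: "snd \<in> borel_measurable ((lebesgue :: real measure) \<Otimes>\<^sub>M (lebesgue :: real measure))"
    by (rule measurable_compose[OF measurable_snd id])
  have [measurable]: "(\<lambda>z. k (fst z) (snd z)) \<in> borel_measurable (lebesgue \<Otimes>\<^sub>M lebesgue)"
    unfolding k_def by measurable
  have Hm: "(\<lambda>z. H (fst z) (snd z)) \<in> borel_measurable (lebesgue \<Otimes>\<^sub>M lebesgue)"
    unfolding H_def by measurable
  have p_abs: "set_borel_measurable lebesgue {a..b} (\<lambda>x. \<bar>p x\<bar>)"
  proof -
    have "(\<lambda>x. \<bar>p' x\<bar>) \<in> borel_measurable lebesgue" by measurable
    then show ?thesis by (simp add: p'_def set_borel_measurable_def abs_mult)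
  qed
  have M': "\<bar>\<bar>p x\<bar>\<bar> \<le> M" if "x \<in> {a..b}" for x using M[OF that] by simp
  define C where "C = M * ((b - a) powr \<gamma> / \<gamma>)"
  have H_eq: "H t x = f' t * (indicator {t..b} x *\<^sub>R ((x - t) powr (\<gamma> - 1) * p x))" if "t \<in> {a..b}" for t x
    using that by (auto simp: H_def p'_def k_def indicator_def)
  have H_eq': "H t x = p' x * (indicator {a..x} t *\<^sub>R ((x - t) powr (\<gamma> - 1) * f t))" if "x \<in> {a..b}" for t x
    using that by (auto simp: H_def f'_def k_def indicator_def)
  have H_abs: "norm (H t x) = \<bar>f' t\<bar> * (indicator {t..b} x *\<^sub>R ((x - t) powr (\<gamma> - 1) * \<bar>p x\<bar>))" if "t \<in> {a..b}" for t x
    by (simp add: H_eq[OF that] abs_mult)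
  have H0: "H t x = 0" if "t \<notin> {a..b}" for t x using that by (simp add: H_def f'_def)
  have H0': "H t x = 0" if "x \<notin> {a..b}" for t x using that by (simp add: H_def p'_def)
  have H_int: "integrable lebesgue (H t)" for t
  proof (cases "t \<in> {a..b}")
    case True
    have Ht: "H t = (\<lambda>x. f' t * (indicator {t..b} x *\<^sub>R ((x - t) powr (\<gamma> - 1) * p x)))"
      by (rule ext) (rule H_eq[OF True])
    show ?thesis
      unfolding Ht
      by (rule integrable_mult_right, rule right_kernel_bounded(1)[OF \<open>0 < \<gamma>\<close> True p M, unfolded set_integrable_def])
  next
    case False
    have "H t = (\<lambda>x. 0)" by (rule ext) (rule H0[OF False])
    then show ?thesis by simp
  qed
  have H_norm: "(\<integral>x. norm (H t x) \<partial>lebesgue) \<le> \<bar>f' t\<bar> * C" for t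
  proof (cases "t \<in> {a..b}")
    case True
    have "(\<integral>x. norm (H t x) \<partial>lebesgue) = \<bar>f' t\<bar> * (LINT x:{t..b}|lebesgue. (x - t) powr (\<gamma> - 1) * \<bar>p x\<bar>)"
      unfolding H_abs[OF True] set_lebesgue_integral_def by simp
    also have "\<dots> \<le> \<bar>f' t\<bar> * C"
      using right_kernel_bounded(2)[OF \<open>0 < \<gamma>\<close> True p_abs M'] unfolding C_def
      by (intro mult_left_mono) auto
    finally show ?thesis .
  next
    case False
    then show ?thesis using H0[OF False] by (simp add: f'_def)
  qed
  have I: "integrable (lebesgue \<Otimes>\<^sub>M lebesgue) (case_prod H)"
  proof (rule P.Fubini_integrable)
    show "case_prod H \<in> borel_measurable (lebesgue \<Otimes>\<^sub>M lebesgue)"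
      using Hm by (simp add: case_prod_unfold)
    show "integrable lebesgue (\<lambda>t. \<integral>x. norm (case_prod H (t, x)) \<partial>lebesgue)"
    proof (rule Bochner_Integration.integrable_bound)
      show "integrable lebesgue (\<lambda>t. \<bar>f' t\<bar> * C)" using f'_int by simp
      show "(\<lambda>t. \<integral>x. norm (case_prod H (t, x)) \<partial>lebesgue) \<in> borel_measurable lebesgue"
        using Hm by (intro borel_measurable_lebesgue_integral) (simp add: case_prod_unfold)
      show "AE t in lebesgue. norm (\<integral>x. norm (case_prod H (t, x)) \<partial>lebesgue) \<le> norm (\<bar>f' t\<bar> * C)"
        using H_norm by (intro AE_I2) (simp add: order_trans[OF _ abs_ge_self])
    qed
    show "AE t in lebesgue. integrable lebesgue (\<lambda>x. case_prod H (t, x))"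
      using H_int by simp
  qed
  have R: "(\<integral>x. H t x \<partial>lebesgue) = Gamma \<gamma> * (indicator {a..b} t *\<^sub>R (f t * right_RL_integral b \<gamma> p t))" for t
  proof (cases "t \<in> {a..b}")
    case True
    have "(\<integral>x. H t x \<partial>lebesgue) = f' t * (LINT x:{t..b}|lebesgue. (x - t) powr (\<gamma> - 1) * p x)"
      unfolding H_eq[OF True] set_lebesgue_integral_def by simp
    then show ?thesis
      using True Gamma_real_pos[OF \<open>0 < \<gamma>\<close>] by (simp add: f'_def right_RL_integral_def)
  next
    case False
    then show ?thesis using H0[OF False] by simp
  qed
  \<comment> \<open>The equation holds for every \<open>x\<close>: where the inner integral fails to
    exist, both sides take the default value 0.\<close>
  have L: "(\<integral>t. H t x \<partial>lebesgue) = Gamma \<gamma> * (indicator {a..b} x *\<^sub>R (p x * left_RL_integral a \<gamma> f x))" for x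
  proof (cases "x \<in> {a..b}")
    case True
    have "(\<integral>t. H t x \<partial>lebesgue) = p' x * (LINT t:{a..x}|lebesgue. (x - t) powr (\<gamma> - 1) * f t)"
      unfolding H_eq'[OF True] set_lebesgue_integral_def by simp
    then show ?thesis
      using True Gamma_real_pos[OF \<open>0 < \<gamma>\<close>] by (simp add: p'_def left_RL_integral_def)
  next
    case False
    then show ?thesis using H0'[OF False] by simp
  qed
  have G: "Gamma \<gamma> \<noteq> 0" using Gamma_real_pos[OF \<open>0 < \<gamma>\<close>] by simp
  show "set_integrable lebesgue {a..b} (\<lambda>t. f t * right_RL_integral b \<gamma> p t)"
    using P.integrable_fst[OF I] G unfolding R set_integrable_def by simp
  show "set_integrable lebesgue {a..b} (\<lambda>x. p x * left_RL_integral a \<gamma> f x)"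
    using P.integrable_snd[OF I] G unfolding L set_integrable_def by simp
  show "(LINT x:{a..b}|lebesgue. p x * left_RL_integral a \<gamma> f x) =
         (LINT t:{a..b}|lebesgue. f t * right_RL_integral b \<gamma> p t)"
    using P.Fubini_integral[OF I] G unfolding L R set_lebesgue_integral_def by simp
qed

section \<open>The first variation\<close>

text \<open>The kernel is 1 except at \<open>t = x\<close>, where \<open>0 powr 0 = 0\<close>, and
  one point is negligible. Ordinary iterated integrals thereby fall under
  \<open>RL_integration_by_parts\<close>.\<close>

lemma left_RL_integral_1:
  assumes "set_integrable lebesgue {a..x} f"
  shows "left_RL_integral a 1 f x = (LINT t:{a..x}|lebesgue. f t)"
proof -
  let ?g = "\<lambda>t. (x - t) powr (1 - 1) * f t"
  have eq: "?g t = f t" if "t \<in> {a..x} - {x}" for t using that by simp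
  have "set_integrable lebesgue {a..x} ?g"
    using absolutely_integrable_spike[OF assms negligible_sing, of x ?g] eq by blast
  then have "(LINT t:{a..x}|lebesgue. ?g t) = integral {a..x} ?g"
    by (rule set_lebesgue_integral_eq_integral(2))
  also have "\<dots> = integral {a..x} f"
    by (rule integral_spike[OF negligible_sing, of _ x]) (use eq in auto)
  also have "\<dots> = (LINT t:{a..x}|lebesgue. f t)"
    using set_lebesgue_integral_eq_integral(2)[OF assms] by simp
  finally show ?thesis unfolding left_RL_integral_def by simp
qed

lemma right_RL_integral_1:
  assumes "set_integrable lebesgue {x..b} f"
  shows "right_RL_integral b 1 f x = (LINT t:{x..b}|lebesgue. f t)"
proof -
  let ?g = "\<lambda>t. (t - x) powr (1 - 1) * f t"
  have eq: "?g t = f t" if "t \<in> {x..b} - {x}" for t using that by simp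
  have "set_integrable lebesgue {x..b} ?g"
    using absolutely_integrable_spike[OF assms negligible_sing, of x ?g] eq by blast
  then have "(LINT t:{x..b}|lebesgue. ?g t) = integral {x..b} ?g"
    by (rule set_lebesgue_integral_eq_integral(2))
  also have "\<dots> = integral {x..b} f"
    by (rule integral_spike[OF negligible_sing, of _ x]) (use eq in auto)
  also have "\<dots> = (LINT t:{x..b}|lebesgue. f t)"
    using set_lebesgue_integral_eq_integral(2)[OF assms] by simp
  finally show ?thesis unfolding right_RL_integral_def by simp
qed

lemma set_integrable_subinterval:
  fixes f :: "real \<Rightarrow> real"
  assumes "set_integrable lebesgue {a..b} f" "a \<le> c" "d \<le> b"
  shows "set_integrable lebesgue {c..d} f"
  by (rule set_integrable_subset[OF assms(1)]) (use assms in auto)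

lemma set_integrable_imp_measurable:
  "set_integrable M A f \<Longrightarrow> set_borel_measurable M A f"
  unfolding set_integrable_def set_borel_measurable_def by (rule borel_measurable_integrable)

lemma continuous_on_interval_bounded:
  fixes p :: "real \<Rightarrow> real"
  assumes "continuous_on {a..b} p"
  obtains M where "\<And>x. x \<in> {a..b} \<Longrightarrow> \<bar>p x\<bar> \<le> M"
proof -
  have "bounded (p ` {a..b})"
    using assms by (intro compact_imp_bounded compact_continuous_image) auto
  then obtain M where "\<forall>x\<in>{a..b}. \<bar>p x\<bar> \<le> M" by (auto simp: bounded_iff)
  then show ?thesis using that by blast
qed

lemma frac_classD:
  assumes "u \<in> frac_class a b \<alpha> \<beta>"
  shows "abs_continuous_on_interval a b u" "continuous_on {a..b} u"
    "continuous_on {a..b} (left_Caputo_derivative a \<alpha> u)"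
    "continuous_on {a..b} (left_RL_integral a \<beta> u)"
  using assms AC_on_imp_continuous_on[OF abs_continuous_imp_AC_on]
  unfolding frac_class_def by auto

text \<open>Since \<open>g\<close> need not be differentiable,
  \<open>RL_integration_by_parts\<close> is used twice: with order \<open>1 - \<alpha>\<close> it
  moves the kernel onto \<open>g\<close>, and with order 1 it moves the integral of \<open>q\<close>
  back onto \<open>deriv f\<close>. The two meet because the integral of order
  \<open>1 - \<alpha>\<close> of \<open>g\<close> equals the integral of \<open>q\<close> from the
  point to \<open>b\<close>.\<close>

lemma Caputo_integration_by_parts:
  fixes a b \<alpha> Q :: real and g q f :: "real \<Rightarrow> real"
  assumes ab: "a < b" and \<alpha>: "\<alpha> < 1"
    and g: "continuous_on {a..b} g" and Q: "\<And>x. x \<in> {a..b} \<Longrightarrow> \<bar>q x\<bar> \<le> Q"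
    and der: "\<And>x. x \<in> {a..b} \<Longrightarrow>
      ((\<lambda>u. LINT t:{u..b}|lebesgue. (t - u) powr (- \<alpha>) * g t) has_vector_derivative
        - (Gamma (1 - \<alpha>) * q x)) (at x within {a..b})"
    and f: "abs_continuous_on_interval a b f"
  shows "set_integrable lebesgue {a..b} q"
    and "(LINT x:{a..b}|lebesgue. g x * left_Caputo_derivative a \<alpha> f x) =
         (LINT x:{a..b}|lebesgue. q x * (f x - f a))"
proof -
  define G where "G = (\<lambda>u. LINT t:{u..b}|lebesgue. (t - u) powr (- \<alpha>) * g t)"
  have Gp: "0 < Gamma (1 - \<alpha>)" using \<alpha> by (intro Gamma_real_pos) simp
  have "(\<lambda>t. indicat_real {b..b} t *\<^sub>R ((t - b) powr - \<alpha> * g t)) = (\<lambda>t. 0)"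
    by (auto simp: indicator_def)
  then have Gb: "G b = 0"
    unfolding G_def set_lebesgue_integral_def by simp
  have G_int: "(q has_integral G t / Gamma (1 - \<alpha>)) {t..b}" if t: "t \<in> {a..b}" for t
  proof -
    \<comment> \<open>The gauge integral recovers \<open>G\<close> from a derivative that exists
      everywhere but may be discontinuous.\<close>
    have "((\<lambda>x. - (Gamma (1 - \<alpha>) * q x)) has_integral (G b - G t)) {t..b}"
    proof (rule fundamental_theorem_of_calculus)
      show "t \<le> b" using t by simp
      show "(G has_vector_derivative - (Gamma (1 - \<alpha>) * q x)) (at x within {t..b})" if "x \<in> {t..b}" for x
        unfolding G_def by (rule has_vector_derivative_within_subset[OF der]) (use that t in auto)
    qed
    from has_integral_mult_right[OF this, of "- 1 / Gamma (1 - \<alpha>)"] show ?thesis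
      using Gp Gb by (simp add: field_simps)
  qed
  \<comment> \<open>Gauge integrability gives measurability; together with the bound
    \<open>Q\<close> it becomes Lebesgue integrability, as Fubini requires.\<close>
  show q_int: "set_integrable lebesgue {a..b} q"
  proof (rule measurable_bounded_by_integrable_imp_absolutely_integrable)
    show "q \<in> borel_measurable (lebesgue_on {a..b})"
      using G_int[of a] ab by (intro integrable_imp_measurable) (auto simp: has_integral_iff)
    show "(\<lambda>x. Q) integrable_on {a..b}" by (simp add: integrable_const_ivl)
  qed (use Q in auto)
  have q_int': "set_integrable lebesgue {t..b} q" if "t \<in> {a..b}" for t
    by (rule set_integrable_subinterval[OF q_int]) (use that in auto)
  have RL_g: "right_RL_integral b (1 - \<alpha>) g t = right_RL_integral b 1 q t" if t: "t \<in> {a..b}" for t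
  proof -
    have "right_RL_integral b 1 q t = integral {t..b} q"
      using right_RL_integral_1[OF q_int'[OF t]] set_lebesgue_integral_eq_integral(2)[OF q_int'[OF t]] by simp
    also have "\<dots> = G t / Gamma (1 - \<alpha>)"
      using G_int[OF t] by (rule integral_unique)
    finally show ?thesis by (simp add: G_def right_RL_integral_def)
  qed
  note ftc = abs_continuous_fundamental_theorem[OF ab f]
  have RL_f: "left_RL_integral a 1 (deriv f) x = f x - f a" if x: "x \<in> {a..b}" for x
    using left_RL_integral_1[OF set_integrable_subinterval[OF ftc(1), of a x]] ftc(2)[OF x] x by simp
  obtain M where M: "\<And>x. x \<in> {a..b} \<Longrightarrow> \<bar>g x\<bar> \<le> M"
    using continuous_on_interval_bounded[OF g] by blast
  have gm: "set_borel_measurable lebesgue {a..b} g"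
    by (rule set_integrable_imp_measurable[OF absolutely_integrable_continuous_real[OF g]])
  \<comment> \<open>The Caputo derivative is the fractional integral of order
    \<open>1 - \<alpha>\<close> of \<open>deriv f\<close>.\<close>
  have "(LINT x:{a..b}|lebesgue. g x * left_Caputo_derivative a \<alpha> f x) =
      (LINT x:{a..b}|lebesgue. g x * left_RL_integral a (1 - \<alpha>) (deriv f) x)"
    by (simp add: left_Caputo_derivative_def left_RL_integral_def)
  also have "\<dots> = (LINT t:{a..b}|lebesgue. deriv f t * right_RL_integral b (1 - \<alpha>) g t)"
    by (rule RL_integration_by_parts(3)[OF _ ftc(1) gm M]) (use \<alpha> in auto)
  also have "\<dots> = (LINT t:{a..b}|lebesgue. deriv f t * right_RL_integral b 1 q t)"
    by (rule set_lebesgue_integral_cong) (use RL_g in auto)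
  also have "\<dots> = (LINT x:{a..b}|lebesgue. q x * left_RL_integral a 1 (deriv f) x)"
    by (rule RL_integration_by_parts(3)[OF _ ftc(1) set_integrable_imp_measurable[OF q_int] Q, symmetric]) auto
  also have "\<dots> = (LINT x:{a..b}|lebesgue. q x * (f x - f a))"
    by (rule set_lebesgue_integral_cong) (use RL_f in auto)
  finally show "(LINT x:{a..b}|lebesgue. g x * left_Caputo_derivative a \<alpha> f x) =
         (LINT x:{a..b}|lebesgue. q x * (f x - f a))" .
qed

lemma right_RL_integral_add:
  assumes "right_RL_integral_exists b \<beta> f x" "right_RL_integral_exists b \<beta> g x"
  shows "right_RL_integral b \<beta> (\<lambda>t. f t + g t) x = right_RL_integral b \<beta> f x + right_RL_integral b \<beta> g x"
  using assms unfolding right_RL_integral_def right_RL_integral_exists_def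
  by (simp add: distrib_left set_integral_add)

text \<open>The memory term is first turned into a weight \<Phi> on \<open>ll\<close>. The integrand
  then reads \<open>A x * h x + g x * V x + p x * W x\<close>, and integration by parts trades
  \<open>V\<close> and \<open>W\<close> for \<open>h\<close>, leaving the Euler--Lagrange expression
  as its factor.\<close>

lemma first_variation_eq_zero:
  fixes a b \<alpha> \<beta> :: real
    and y u Ly Lv Lw Lz ly lv lw \<Phi> :: "real \<Rightarrow> real"
  defines "h \<equiv> \<lambda>x. u x - y x"
    and "V \<equiv> \<lambda>x. left_Caputo_derivative a \<alpha> u x - left_Caputo_derivative a \<alpha> y x"
    and "W \<equiv> \<lambda>x. left_RL_integral a \<beta> u x - left_RL_integral a \<beta> y x"
  assumes ab: "a < b" and \<alpha>: "\<alpha> < 1" and \<beta>: "0 < \<beta>"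
    and y: "y \<in> frac_class a b \<alpha> \<beta>" and u: "u \<in> frac_class a b \<alpha> \<beta>" and ua: "u a = y a"
    and cont: "continuous_on {a..b} Ly" "continuous_on {a..b} Lv" "continuous_on {a..b} Lw"
      "continuous_on {a..b} Lz" "continuous_on {a..b} ly" "continuous_on {a..b} lv" "continuous_on {a..b} lw"
    and \<Phi>: "\<And>x. \<Phi> x = (LINT t:{x..b}|lebesgue. Lz t)"
    and ex: "\<And>x. x \<in> {a..b} \<Longrightarrow> right_RL_derivative_exists a b \<alpha> Lv x"
      "\<And>x. x \<in> {a..b} \<Longrightarrow> right_RL_integral_exists b \<beta> Lw x"
      "\<And>x. x \<in> {a..b} \<Longrightarrow> right_RL_derivative_exists a b \<alpha> (\<lambda>u. \<Phi> u * lv u) x"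
      "\<And>x. x \<in> {a..b} \<Longrightarrow> right_RL_integral_exists b \<beta> (\<lambda>u. \<Phi> u * lw u) x"
    and EL: "\<And>x. x \<in> {a..b} \<Longrightarrow>
      Ly x + right_RL_derivative a b \<alpha> Lv x + right_RL_integral b \<beta> Lw x + \<Phi> x * ly x
        + right_RL_derivative a b \<alpha> (\<lambda>u. \<Phi> u * lv u) x
        + right_RL_integral b \<beta> (\<lambda>u. \<Phi> u * lw u) x = 0"
  defines "ll \<equiv> \<lambda>x. ly x * h x + lv x * V x + lw x * W x"
  shows "(LINT x:{a..b}|lebesgue. Ly x * h x + Lv x * V x + Lw x * W x
      + Lz x * (LINT t:{a..x}|lebesgue. ll t)) = 0"
proof -
  note Dy = frac_classD[OF y] and Du = frac_classD[OF u]
  have Lz_int: "set_integrable lebesgue {x..b} Lz" if "a \<le> x" for x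
    by (rule absolutely_integrable_continuous_real, rule continuous_on_subset[OF cont(4)]) (use that in auto)
  have \<Phi>_eq: "\<Phi> x = integral {x..b} Lz" if "x \<in> {a..b}" for x
    using set_lebesgue_integral_eq_integral(2)[OF Lz_int] that \<Phi> by simp
  have "continuous_on {a..b} (\<lambda>x. integral {x..b} Lz)"
    by (rule indefinite_integral_continuous_1') (rule integrable_continuous_real[OF cont(4)])
  then have c\<Phi>: "continuous_on {a..b} \<Phi>"
    by (subst continuous_on_cong[OF refl \<Phi>_eq])
  have ch: "continuous_on {a..b} h" and cV: "continuous_on {a..b} V" and cW: "continuous_on {a..b} W"
    unfolding h_def V_def W_def by (intro continuous_intros Dy Du)+
  have cl: "continuous_on {a..b} ll"
    unfolding ll_def by (intro continuous_intros cont ch cV cW)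
  note ci = absolutely_integrable_continuous_real
  define g where "g = (\<lambda>x. Lv x + \<Phi> x * lv x)"
  define p where "p = (\<lambda>x. Lw x + \<Phi> x * lw x)"
  define A where "A = (\<lambda>x. Ly x + \<Phi> x * ly x)"
  have cg: "continuous_on {a..b} g" and cp: "continuous_on {a..b} p" and cA: "continuous_on {a..b} A"
    unfolding g_def p_def A_def by (intro continuous_intros cont c\<Phi>)+
  define q where "q = (\<lambda>x. right_RL_derivative a b \<alpha> Lv x + right_RL_derivative a b \<alpha> (\<lambda>u. \<Phi> u * lv u) x)"
  have RLp: "right_RL_integral b \<beta> p x = right_RL_integral b \<beta> Lw x + right_RL_integral b \<beta> (\<lambda>u. \<Phi> u * lw u) x"
    if "x \<in> {a..b}" for x
    unfolding p_def by (rule right_RL_integral_add) (use ex that in auto)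
  have q_eq: "A x + q x + right_RL_integral b \<beta> p x = 0" if "x \<in> {a..b}" for x
    using EL[OF that] RLp[OF that] by (simp add: A_def q_def)
  obtain Mp where Mp: "\<And>x. x \<in> {a..b} \<Longrightarrow> \<bar>p x\<bar> \<le> Mp"
    using continuous_on_interval_bounded[OF cp] by blast
  obtain MA where MA: "\<And>x. x \<in> {a..b} \<Longrightarrow> \<bar>A x\<bar> \<le> MA"
    using continuous_on_interval_bounded[OF cA] by blast
  obtain MLz where MLz: "\<And>x. x \<in> {a..b} \<Longrightarrow> \<bar>Lz x\<bar> \<le> MLz"
    using continuous_on_interval_bounded[OF cont(4)] by blast
  have pm: "set_borel_measurable lebesgue {a..b} p"
    by (rule set_integrable_imp_measurable[OF ci[OF cp]])
  have Gb: "0 < Gamma \<beta>" using \<beta> by (rule Gamma_real_pos)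
  \<comment> \<open>The equation is solved for \<open>q\<close>: the continuous \<open>A\<close> is
    bounded, and so is the fractional integral of the bounded \<open>p\<close>.\<close>
  have q_bd: "\<bar>q x\<bar> \<le> MA + Mp * ((b - a) powr \<beta> / \<beta>) / Gamma \<beta>" if x: "x \<in> {a..b}" for x
  proof -
    have "\<bar>right_RL_integral b \<beta> p x\<bar> \<le> Mp * ((b - a) powr \<beta> / \<beta>) / Gamma \<beta>"
      using divide_right_mono[OF right_kernel_bounded(2)[OF \<beta> x pm Mp] less_imp_le[OF Gb]] Gb
      by (simp add: right_RL_integral_def abs_mult)
    then show ?thesis using q_eq[OF x] MA[OF x] by linarith
  qed
  have der: "((\<lambda>u. LINT t:{u..b}|lebesgue. (t - u) powr (- \<alpha>) * g t) has_vector_derivative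
      - (Gamma (1 - \<alpha>) * q x)) (at x within {a..b})" if x: "x \<in> {a..b}" for x
  proof -
    let ?G = "\<lambda>f u. LINT t:{u..b}|lebesgue. (t - u) powr (- \<alpha>) * f t"
    have "0 < Gamma (1 - \<alpha>)" using \<alpha> by (intro Gamma_real_pos) simp
    then have G0: "Gamma (1 - \<alpha>) \<noteq> 0" by linarith
    have d: "(?G f has_vector_derivative - (Gamma (1 - \<alpha>) * right_RL_derivative a b \<alpha> f x)) (at x within {a..b})"
      if "right_RL_derivative_exists a b \<alpha> f x" for f
      using that G0 vector_derivative_works[of "?G f" "at x within {a..b}"]
      by (simp add: right_RL_derivative_exists_def right_RL_derivative_def)
    have "((\<lambda>u. ?G Lv u + ?G (\<lambda>u. \<Phi> u * lv u) u) has_vector_derivative - (Gamma (1 - \<alpha>) * q x)) (at x within {a..b})"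
      using has_vector_derivative_add[OF d[OF ex(1)[OF x]] d[OF ex(3)[OF x]]]
      by (simp add: q_def distrib_left)
    \<comment> \<open>The inner integrals add up to the one of \<open>g\<close> only on
      \<open>{a..b}\<close>, where each of them exists; the derivative is taken within that
      set.\<close>
    then show ?thesis
    proof (rule has_vector_derivative_transform[OF x, rotated])
      fix v assume "v \<in> {a..b}"
      then have "set_integrable lebesgue {v..b} (\<lambda>t. (t - v) powr (- \<alpha>) * Lv t)"
        "set_integrable lebesgue {v..b} (\<lambda>t. (t - v) powr (- \<alpha>) * (\<Phi> t * lv t))"
        using ex(1)[OF x] ex(3)[OF x] unfolding right_RL_derivative_exists_def by blast+
      then show "?G g v = ?G Lv v + ?G (\<lambda>u. \<Phi> u * lv u) v"
        by (simp add: g_def distrib_left set_integral_add)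
    qed
  qed
  have Cap: "set_integrable lebesgue {a..b} q"
    "(LINT x:{a..b}|lebesgue. g x * left_Caputo_derivative a \<alpha> f x) =
      (LINT x:{a..b}|lebesgue. q x * (f x - f a))" if "abs_continuous_on_interval a b f" for f
    by (rule Caputo_integration_by_parts[OF ab \<alpha> cg], erule q_bd, erule der, rule that)+
  have q_int: "set_integrable lebesgue {a..b} q" by (rule Cap(1)[OF Dy(1)])
  have qm: "set_integrable lebesgue {a..b} (\<lambda>x. q x * f x)" if f: "continuous_on {a..b} f" for f
  proof -
    have "(\<lambda>x. f x * q x) absolutely_integrable_on {a..b}"
    proof (rule absolutely_integrable_bounded_measurable_product_real[OF _ _ _ q_int])
      show "f \<in> borel_measurable (lebesgue_on {a..b})"
        by (rule continuous_imp_measurable_on_sets_lebesgue[OF f]) simp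
      show "bounded (f ` {a..b})"
        by (intro compact_imp_bounded compact_continuous_image f) simp
    qed simp
    then show ?thesis by (simp add: mult.commute)
  qed
  \<comment> \<open>Parts is applied to \<open>u\<close> and \<open>y\<close> separately, which
    avoids differentiating \<open>h\<close>; the boundary values cancel by
    \<open>ua\<close>.\<close>
  have I1: "(LINT x:{a..b}|lebesgue. g x * V x) = (LINT x:{a..b}|lebesgue. q x * h x)"
  proof -
    have "(LINT x:{a..b}|lebesgue. g x * V x) =
      (LINT x:{a..b}|lebesgue. g x * left_Caputo_derivative a \<alpha> u x)
      - (LINT x:{a..b}|lebesgue. g x * left_Caputo_derivative a \<alpha> y x)"
      unfolding V_def right_diff_distrib
      by (rule set_integral_diff(2)) (intro ci continuous_intros cg Dy Du)+
    also have "\<dots> = (LINT x:{a..b}|lebesgue. q x * (u x - u a)) - (LINT x:{a..b}|lebesgue. q x * (y x - y a))"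
      using Cap(2)[OF Du(1)] Cap(2)[OF Dy(1)] by simp
    also have "\<dots> = (LINT x:{a..b}|lebesgue. q x * (u x - u a) - q x * (y x - y a))"
      by (rule set_integral_diff(2)[symmetric]) (intro qm continuous_intros Dy Du)+
    finally show ?thesis by (simp add: h_def ua algebra_simps)
  qed
  have RL: "set_integrable lebesgue {a..b} (\<lambda>t. f t * right_RL_integral b \<beta> p t)"
     "(LINT x:{a..b}|lebesgue. p x * left_RL_integral a \<beta> f x) =
         (LINT t:{a..b}|lebesgue. f t * right_RL_integral b \<beta> p t)" if f: "continuous_on {a..b} f" for f
    by (rule RL_integration_by_parts[OF \<beta> ci[OF f] pm Mp], assumption)+
  have I2: "(LINT x:{a..b}|lebesgue. p x * W x) = (LINT x:{a..b}|lebesgue. h x * right_RL_integral b \<beta> p x)"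
  proof -
    have "(LINT x:{a..b}|lebesgue. p x * W x) =
      (LINT x:{a..b}|lebesgue. p x * left_RL_integral a \<beta> u x)
      - (LINT x:{a..b}|lebesgue. p x * left_RL_integral a \<beta> y x)"
      unfolding W_def right_diff_distrib
      by (rule set_integral_diff(2)) (intro ci continuous_intros cp Dy Du)+
    also have "\<dots> = (LINT x:{a..b}|lebesgue. u x * right_RL_integral b \<beta> p x)
        - (LINT x:{a..b}|lebesgue. y x * right_RL_integral b \<beta> p x)"
      using RL(2)[OF Du(2)] RL(2)[OF Dy(2)] by simp
    also have "\<dots> = (LINT x:{a..b}|lebesgue. u x * right_RL_integral b \<beta> p x - y x * right_RL_integral b \<beta> p x)"
      by (rule set_integral_diff(2)[symmetric]) (intro RL Dy Du)+
    finally show ?thesis by (simp add: h_def algebra_simps)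
  qed
  have Lzm: "set_borel_measurable lebesgue {a..b} Lz"
    by (rule set_integrable_imp_measurable[OF ci[OF cont(4)]])
  have l_int: "set_integrable lebesgue {a..x} ll" if "x \<in> {a..b}" for x
    by (rule set_integrable_subinterval[OF ci[OF cl]]) (use that in auto)
  \<comment> \<open>Interchanging the order of integration is integration by parts of order 1; the
    weight collected by \<open>ll x\<close> is the integral of \<open>Lz\<close> from
    \<open>x\<close> to \<open>b\<close>.\<close>
  have I3: "(LINT x:{a..b}|lebesgue. Lz x * (LINT t:{a..x}|lebesgue. ll t)) =
      (LINT x:{a..b}|lebesgue. ll x * \<Phi> x)"
    and I3i: "set_integrable lebesgue {a..b} (\<lambda>x. Lz x * (LINT t:{a..x}|lebesgue. ll t))"
  proof -
    have l: "(LINT t:{a..x}|lebesgue. ll t) = left_RL_integral a 1 ll x" if "x \<in> {a..b}" for x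
      using left_RL_integral_1[OF l_int[OF that]] by simp
    have r: "right_RL_integral b 1 Lz x = \<Phi> x" if "x \<in> {a..b}" for x
      using right_RL_integral_1[OF Lz_int[of x]] that \<Phi> by simp
    note RL1 = RL_integration_by_parts[OF zero_less_one ci[OF cl] Lzm MLz, simplified]
    have "(LINT x:{a..b}|lebesgue. Lz x * (LINT t:{a..x}|lebesgue. ll t)) =
        (LINT x:{a..b}|lebesgue. Lz x * left_RL_integral a 1 ll x)"
      by (rule set_lebesgue_integral_cong) (use l in auto)
    also have "\<dots> = (LINT x:{a..b}|lebesgue. ll x * right_RL_integral b 1 Lz x)"
      by (rule RL1(3))
    also have "\<dots> = (LINT x:{a..b}|lebesgue. ll x * \<Phi> x)"
      by (rule set_lebesgue_integral_cong) (use r in auto)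
    finally show "(LINT x:{a..b}|lebesgue. Lz x * (LINT t:{a..x}|lebesgue. ll t)) =
      (LINT x:{a..b}|lebesgue. ll x * \<Phi> x)" .
    show "set_integrable lebesgue {a..b} (\<lambda>x. Lz x * (LINT t:{a..x}|lebesgue. ll t))"
    proof (subst set_integrable_cong[OF refl])
      show "set_integrable lebesgue {a..b} (\<lambda>x. Lz x * left_RL_integral a 1 ll x)" by (rule RL1(1))
    qed (use l in auto)
  qed
  have i: "set_integrable lebesgue {a..b} (\<lambda>x. A x * h x)" "set_integrable lebesgue {a..b} (\<lambda>x. g x * V x)"
    "set_integrable lebesgue {a..b} (\<lambda>x. p x * W x)"
    by (intro ci continuous_intros cA cg cp ch cV cW)+
  have "(LINT x:{a..b}|lebesgue. Ly x * h x + Lv x * V x + Lw x * W x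
      + Lz x * (LINT t:{a..x}|lebesgue. ll t)) =
      (LINT x:{a..b}|lebesgue. Ly x * h x + Lv x * V x + Lw x * W x) + (LINT x:{a..b}|lebesgue. ll x * \<Phi> x)"
    unfolding I3[symmetric]
    by (rule set_integral_add(2)[OF _ I3i]) (intro ci continuous_intros cont ch cV cW)
  also have "\<dots> = (LINT x:{a..b}|lebesgue. (Ly x * h x + Lv x * V x + Lw x * W x) + ll x * \<Phi> x)"
    by (rule set_integral_add(2)[symmetric]) (intro ci continuous_intros cont ch cV cW cl c\<Phi>)+
  also have "\<dots> = (LINT x:{a..b}|lebesgue. (A x * h x + g x * V x) + p x * W x)"
    by (rule arg_cong[where f = "set_lebesgue_integral lebesgue {a..b}"], rule ext)
      (simp add: A_def g_def p_def ll_def algebra_simps)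
  also have "\<dots> = (LINT x:{a..b}|lebesgue. A x * h x) + (LINT x:{a..b}|lebesgue. g x * V x)
      + (LINT x:{a..b}|lebesgue. p x * W x)"
    using i by (simp add: set_integral_add)
  also have "\<dots> = (LINT x:{a..b}|lebesgue. (A x * h x + q x * h x) + h x * right_RL_integral b \<beta> p x)"
    unfolding I1 I2 using i(1) qm[OF ch] RL(1)[OF ch] by (simp add: set_integral_add)
  also have "\<dots> = (LINT x:{a..b}|lebesgue. 0)"
  proof (rule set_lebesgue_integral_cong)
    show "\<forall>x. x \<in> {a..b} \<longrightarrow> (A x * h x + q x * h x) + h x * right_RL_integral b \<beta> p x = 0"
    proof (intro allI impI)
      fix x assume x: "x \<in> {a..b}"
      have "(A x * h x + q x * h x) + h x * right_RL_integral b \<beta> p x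
          = h x * (A x + q x + right_RL_integral b \<beta> p x)" by (simp add: algebra_simps)
      then show "(A x * h x + q x * h x) + h x * right_RL_integral b \<beta> p x = 0"
        using q_eq[OF x] by simp
    qed
  qed simp
  finally show ?thesis by simp
qed

section \<open>Sufficiency\<close>

lemma C1_on_imp_continuous_on: "C1_on D \<Psi> \<Longrightarrow> continuous_on D \<Psi>"
  unfolding C1_on_def
  by (auto simp: continuous_on_eq_continuous_within intro: has_derivative_continuous)

lemma convex_in_varsD:
  assumes "convex_in_vars I D \<Psi>" "p \<in> D" "p + \<tau> \<in> D"
  shows "(\<Sum>i\<in>I. partial_deriv i \<Psi> p * (\<tau> \<bullet> i)) \<le> \<Psi> (p + \<tau>) - \<Psi> p"
  using assms unfolding convex_in_vars_def by blast

lemma concave_in_varsD: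
  assumes "concave_in_vars I D \<Psi>" "p \<in> D" "p + \<tau> \<in> D"
  shows "\<Psi> (p + \<tau>) - \<Psi> p \<le> (\<Sum>i\<in>I. partial_deriv i \<Psi> p * (\<tau> \<bullet> i))"
  using assms unfolding concave_in_vars_def by blast

lemma continuous_on_curly:
  assumes "u \<in> frac_class a b \<alpha> \<beta>"
  shows "continuous_on {a..b} (curly a \<alpha> \<beta> u)"
  unfolding curly_def by (intro continuous_intros frac_classD[OF assms])

text \<open>\<open>curly\<close> and \<open>bracket\<close> carry the parameter as first coordinate,
  so these curves remain in the strip where \<Psi> is continuous.\<close>

lemma continuous_on_compose_strip:
  fixes \<Psi> :: "real \<times> 'a::topological_space \<Rightarrow> 'b::topological_space"
  assumes "continuous_on ({a..b} \<times> UNIV) \<Psi>" "continuous_on {a..b} c" "\<And>x. fst (c x) = x"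
  shows "continuous_on {a..b} (\<lambda>x. \<Psi> (c x))"
  by (rule continuous_on_compose2[OF assms(1,2)], rule image_subsetI) (simp add: mem_Times_iff assms(3))

lemma continuous_on_bracket:
  assumes u: "u \<in> frac_class a b \<alpha> \<beta>" and l: "continuous_on ({a..b} \<times> UNIV) l"
  shows "continuous_on {a..b} (bracket a \<alpha> \<beta> l u)"
proof -
  have c: "continuous_on {a..b} (\<lambda>t. l (curly a \<alpha> \<beta> u t))"
    by (rule continuous_on_compose_strip[OF l continuous_on_curly[OF u]]) (simp add: curly_def)
  have "indef a \<alpha> \<beta> l u x = integral {a..x} (\<lambda>t. l (curly a \<alpha> \<beta> u t))" if "x \<in> {a..b}" for x
    unfolding indef_def
    by (rule set_lebesgue_integral_eq_integral(2),
        rule set_integrable_subinterval[OF absolutely_integrable_continuous_real[OF c]]) (use that in auto)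
  moreover have "continuous_on {a..b} (\<lambda>x. integral {a..x} (\<lambda>t. l (curly a \<alpha> \<beta> u t)))"
    by (rule indefinite_integral_continuous_1) (rule integrable_continuous_real[OF c])
  ultimately have "continuous_on {a..b} (indef a \<alpha> \<beta> l u)"
    by (subst continuous_on_cong[OF refl]) auto
  then show ?thesis
    unfolding bracket_def by (intro continuous_intros frac_classD[OF u])
qed

theorem theorem26:
  fixes a b \<alpha> \<beta> y\<^sub>a y\<^sub>b :: real
    and L :: "real \<times> real \<times> real \<times> real \<times> real \<Rightarrow> real"
    and l :: "real \<times> real \<times> real \<times> real \<Rightarrow> real"
    and y :: "real \<Rightarrow> real"
  assumes "a < b" and "0 < \<alpha>" and "\<alpha> < 1" and "0 < \<beta>"
    and "C1_on ({a..b} \<times> UNIV) L"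
    and "C1_on ({a..b} \<times> UNIV) l"
    and "y \<in> frac_class a b \<alpha> \<beta>"
    and "y a = y\<^sub>a" and "y b = y\<^sub>b"
    and "Euler_Lagrange_solution a b \<alpha> \<beta> L l y"
    and "convex_in_vars {(0,1,0,0,0), (0,0,1,0,0), (0,0,0,1,0), (0,0,0,0,1)} ({a..b} \<times> UNIV) L"
    and "convex_in_vars {(0,1,0,0), (0,0,1,0), (0,0,0,1)} ({a..b} \<times> UNIV) l \<and>
           (\<forall>x\<in>{a..b}. partial_deriv (0,0,0,0,1) L (bracket a \<alpha> \<beta> l y x) \<ge> 0)
         \<or> concave_in_vars {(0,1,0,0), (0,0,1,0), (0,0,0,1)} ({a..b} \<times> UNIV) l \<and>
           (\<forall>x\<in>{a..b}. partial_deriv (0,0,0,0,1) L (bracket a \<alpha> \<beta> l y x) \<le> 0)"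
  shows "is_arg_min (functional_J a b \<alpha> \<beta> L l)
           (\<lambda>u. u \<in> frac_class a b \<alpha> \<beta> \<and> u a = y\<^sub>a \<and> u b = y\<^sub>b) y"
proof -
  note ab = \<open>a < b\<close> and y = \<open>y \<in> frac_class a b \<alpha> \<beta>\<close>
  define Ly where "Ly = (\<lambda>x. partial_deriv (0,1,0,0,0) L (bracket a \<alpha> \<beta> l y x))"
  define Lv where "Lv = (\<lambda>x. partial_deriv (0,0,1,0,0) L (bracket a \<alpha> \<beta> l y x))"
  define Lw where "Lw = (\<lambda>x. partial_deriv (0,0,0,1,0) L (bracket a \<alpha> \<beta> l y x))"
  define Lz where "Lz = (\<lambda>x. partial_deriv (0,0,0,0,1) L (bracket a \<alpha> \<beta> l y x))"
  define ly where "ly = (\<lambda>x. partial_deriv (0,1,0,0) l (curly a \<alpha> \<beta> y x))"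
  define lv where "lv = (\<lambda>x. partial_deriv (0,0,1,0) l (curly a \<alpha> \<beta> y x))"
  define lw where "lw = (\<lambda>x. partial_deriv (0,0,0,1) l (curly a \<alpha> \<beta> y x))"
  define \<Phi> where "\<Phi> = (\<lambda>x. LINT t:{x..b}|lebesgue. Lz t)"
  have EL: "right_RL_derivative_exists a b \<alpha> Lv x \<and>
      right_RL_integral_exists b \<beta> Lw x \<and>
      right_RL_derivative_exists a b \<alpha> (\<lambda>u. \<Phi> u * lv u) x \<and>
      right_RL_integral_exists b \<beta> (\<lambda>u. \<Phi> u * lw u) x \<and>
      Ly x + right_RL_derivative a b \<alpha> Lv x + right_RL_integral b \<beta> Lw x + \<Phi> x * ly x
        + right_RL_derivative a b \<alpha> (\<lambda>u. \<Phi> u * lv u) x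
        + right_RL_integral b \<beta> (\<lambda>u. \<Phi> u * lw u) x = 0" if "x \<in> {a..b}" for x
    using bspec[OF assms(10)[unfolded Euler_Lagrange_solution_def Let_def] that]
    unfolding \<Phi>_def Ly_def Lv_def Lw_def Lz_def ly_def lv_def lw_def .
  have Lc: "continuous_on ({a..b} \<times> UNIV) L" and lc: "continuous_on ({a..b} \<times> UNIV) l"
    using assms(5,6) by (auto intro: C1_on_imp_continuous_on)
  have cl: "continuous_on {a..b} (\<lambda>t. l (curly a \<alpha> \<beta> u t))" if "u \<in> frac_class a b \<alpha> \<beta>" for u
    by (rule continuous_on_compose_strip[OF lc continuous_on_curly[OF that]]) (simp add: curly_def)
  have cL: "continuous_on {a..b} (\<lambda>t. L (bracket a \<alpha> \<beta> l u t))" if "u \<in> frac_class a b \<alpha> \<beta>" for u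
    by (rule continuous_on_compose_strip[OF Lc continuous_on_bracket[OF that lc]]) (simp add: bracket_def)
  have pL: "continuous_on {a..b} (\<lambda>x. partial_deriv i L (bracket a \<alpha> \<beta> l y x))"
    if "i \<in> {(0,1,0,0,0), (0,0,1,0,0), (0,0,0,1,0), (0,0,0,0,1)}" for i
  proof (rule continuous_on_compose_strip[OF _ continuous_on_bracket[OF y lc]])
    show "continuous_on ({a..b} \<times> UNIV) (partial_deriv i L)"
      using that assms(11) unfolding convex_in_vars_def has_continuous_partials_on_def by blast
  qed (simp add: bracket_def)
  have pl: "continuous_on {a..b} (\<lambda>x. partial_deriv i l (curly a \<alpha> \<beta> y x))"
    if "i \<in> {(0,1,0,0), (0,0,1,0), (0,0,0,1)}" for i
  proof (rule continuous_on_compose_strip[OF _ continuous_on_curly[OF y]])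
    show "continuous_on ({a..b} \<times> UNIV) (partial_deriv i l)"
      using that assms(12) unfolding convex_in_vars_def concave_in_vars_def has_continuous_partials_on_def
      by blast
  qed (simp add: curly_def)
  have cont: "continuous_on {a..b} Ly" "continuous_on {a..b} Lv" "continuous_on {a..b} Lw"
      "continuous_on {a..b} Lz" "continuous_on {a..b} ly" "continuous_on {a..b} lv" "continuous_on {a..b} lw"
    unfolding Ly_def Lv_def Lw_def Lz_def ly_def lv_def lw_def by (intro pL pl; simp)+
  note ci = absolutely_integrable_continuous_real
  have "functional_J a b \<alpha> \<beta> L l y \<le> functional_J a b \<alpha> \<beta> L l u"
    if u: "u \<in> frac_class a b \<alpha> \<beta>" and ua: "u a = y a" for u
  proof -
    define h where "h = (\<lambda>x. u x - y x)"
    define V where "V = (\<lambda>x. left_Caputo_derivative a \<alpha> u x - left_Caputo_derivative a \<alpha> y x)"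
    define W where "W = (\<lambda>x. left_RL_integral a \<beta> u x - left_RL_integral a \<beta> y x)"
    define ll where "ll = (\<lambda>x. ly x * h x + lv x * V x + lw x * W x)"
    \<comment> \<open>The first variation integrand at \<open>y\<close> in direction
      \<open>h\<close>, with the increment of \<open>z\<close> replaced by its linearization, the
      integral of \<open>ll\<close>.\<close>
    define E where "E = (\<lambda>x. Ly x * h x + Lv x * V x + Lw x * W x + Lz x * (LINT t:{a..x}|lebesgue. ll t))"
    have zero: "(LINT x:{a..b}|lebesgue. E x) = 0"
      unfolding E_def ll_def h_def V_def W_def
      by (rule first_variation_eq_zero[OF ab \<open>\<alpha> < 1\<close> \<open>0 < \<beta>\<close> y u ua cont fun_cong[OF \<Phi>_def]])
        (use EL in blast)+
    have chVW: "continuous_on {a..b} h" "continuous_on {a..b} V" "continuous_on {a..b} W"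
      unfolding h_def V_def W_def by (intro continuous_intros frac_classD[OF y] frac_classD[OF u])+
    have cll: "continuous_on {a..b} ll"
      unfolding ll_def by (intro continuous_intros cont chVW)
    have "continuous_on {a..b} (\<lambda>x. integral {a..x} ll)"
      by (rule indefinite_integral_continuous_1) (rule integrable_continuous_real[OF cll])
    moreover have ll_int: "set_integrable lebesgue {a..x} ll" if "x \<in> {a..b}" for x
      by (rule set_integrable_subinterval[OF ci[OF cll]]) (use that in auto)
    ultimately have "continuous_on {a..b} (\<lambda>x. LINT t:{a..x}|lebesgue. ll t)"
      by (subst continuous_on_cong[OF refl]) (auto intro!: set_lebesgue_integral_eq_integral(2))
    then have E_int: "set_integrable lebesgue {a..b} E"
      unfolding E_def by (intro ci continuous_intros cont chVW)
    have l_int: "set_integrable lebesgue {a..x} (\<lambda>t. l (curly a \<alpha> \<beta> v t))"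
      if "v \<in> frac_class a b \<alpha> \<beta>" "x \<in> {a..b}" for v x
      by (rule set_integrable_subinterval[OF ci[OF cl[OF that(1)]]]) (use that in auto)
    \<comment> \<open>Both curves are compared at the same parameter, so the first increment is 0
      and the convexity inequality involves only the remaining variables.\<close>
    have \<tau>l: "curly a \<alpha> \<beta> u t = curly a \<alpha> \<beta> y t + (0, h t, V t, W t)" for t
      by (simp add: curly_def h_def V_def W_def)
    have indef_diff: "indef a \<alpha> \<beta> l u x - indef a \<alpha> \<beta> l y x =
        (LINT t:{a..x}|lebesgue. l (curly a \<alpha> \<beta> u t) - l (curly a \<alpha> \<beta> y t))" if "x \<in> {a..b}" for x
      unfolding indef_def by (rule set_integral_diff(2)[symmetric]) (intro l_int u y that)+
    \<comment> \<open>Convexity bounds the increment of \<open>z\<close> from below by its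
      linearization, concavity from above. The sign of \<open>Lz\<close> in each alternative turns
      this into the same inequality.\<close>
    have Z: "Lz x * (LINT t:{a..x}|lebesgue. ll t) \<le> Lz x * (indef a \<alpha> \<beta> l u x - indef a \<alpha> \<beta> l y x)"
      if x: "x \<in> {a..b}" for x
      using assms(12)
    proof
      assume *: "convex_in_vars {(0,1,0,0), (0,0,1,0), (0,0,0,1)} ({a..b} \<times> UNIV) l \<and>
           (\<forall>x\<in>{a..b}. partial_deriv (0,0,0,0,1) L (bracket a \<alpha> \<beta> l y x) \<ge> 0)"
      have "ll t \<le> l (curly a \<alpha> \<beta> u t) - l (curly a \<alpha> \<beta> y t)" if t: "t \<in> {a..b}" for t
      proof -
        have "curly a \<alpha> \<beta> y t \<in> {a..b} \<times> UNIV" "curly a \<alpha> \<beta> y t + (0, h t, V t, W t) \<in> {a..b} \<times> UNIV"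
          using t by (simp_all add: curly_def)
        then have "(\<Sum>i\<in>{(0,1,0,0), (0,0,1,0), (0,0,0,1)}. partial_deriv i l (curly a \<alpha> \<beta> y t) * ((0, h t, V t, W t) \<bullet> i))
          \<le> l (curly a \<alpha> \<beta> y t + (0, h t, V t, W t)) - l (curly a \<alpha> \<beta> y t)"
          by (rule convex_in_varsD[OF conjunct1[OF *]])
        then show ?thesis unfolding \<tau>l by (simp add: ll_def ly_def lv_def lw_def)
      qed
      then have "(LINT t:{a..x}|lebesgue. ll t) \<le> indef a \<alpha> \<beta> l u x - indef a \<alpha> \<beta> l y x"
        unfolding indef_diff[OF x] using x
        by (intro set_integral_mono ll_int set_integral_diff(1) l_int u y) auto
      moreover have "Lz x \<ge> 0" using * x by (simp add: Lz_def)
      ultimately show ?thesis by (rule mult_left_mono)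
    next
      assume *: "concave_in_vars {(0,1,0,0), (0,0,1,0), (0,0,0,1)} ({a..b} \<times> UNIV) l \<and>
           (\<forall>x\<in>{a..b}. partial_deriv (0,0,0,0,1) L (bracket a \<alpha> \<beta> l y x) \<le> 0)"
      have "l (curly a \<alpha> \<beta> u t) - l (curly a \<alpha> \<beta> y t) \<le> ll t" if t: "t \<in> {a..b}" for t
      proof -
        have "curly a \<alpha> \<beta> y t \<in> {a..b} \<times> UNIV" "curly a \<alpha> \<beta> y t + (0, h t, V t, W t) \<in> {a..b} \<times> UNIV"
          using t by (simp_all add: curly_def)
        then have "l (curly a \<alpha> \<beta> y t + (0, h t, V t, W t)) - l (curly a \<alpha> \<beta> y t) \<le>
          (\<Sum>i\<in>{(0,1,0,0), (0,0,1,0), (0,0,0,1)}. partial_deriv i l (curly a \<alpha> \<beta> y t) * ((0, h t, V t, W t) \<bullet> i))"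
          by (rule concave_in_varsD[OF conjunct1[OF *]])
        then show ?thesis unfolding \<tau>l by (simp add: ll_def ly_def lv_def lw_def)
      qed
      then have "indef a \<alpha> \<beta> l u x - indef a \<alpha> \<beta> l y x \<le> (LINT t:{a..x}|lebesgue. ll t)"
        unfolding indef_diff[OF x] using x
        by (intro set_integral_mono ll_int set_integral_diff(1) l_int u y) auto
      moreover have "Lz x \<le> 0" using * x by (simp add: Lz_def)
      ultimately show ?thesis by (rule mult_left_mono_neg)
    qed
    \<comment> \<open>Convexity of \<open>L\<close> produces the true increment of \<open>z\<close>;
      \<open>Z\<close> then lowers it to the linearized one.\<close>
    have E_le: "E x \<le> L (bracket a \<alpha> \<beta> l u x) - L (bracket a \<alpha> \<beta> l y x)" if x: "x \<in> {a..b}" for x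
    proof -
      define \<tau> where "\<tau> = (0::real, h x, V x, W x, indef a \<alpha> \<beta> l u x - indef a \<alpha> \<beta> l y x)"
      have \<tau>: "bracket a \<alpha> \<beta> l u x = bracket a \<alpha> \<beta> l y x + \<tau>"
        by (simp add: \<tau>_def bracket_def h_def V_def W_def)
      have "bracket a \<alpha> \<beta> l y x \<in> {a..b} \<times> UNIV" "bracket a \<alpha> \<beta> l y x + \<tau> \<in> {a..b} \<times> UNIV"
        using x unfolding \<tau>[symmetric] by (simp_all add: bracket_def)
      then have "(\<Sum>i\<in>{(0,1,0,0,0), (0,0,1,0,0), (0,0,0,1,0), (0,0,0,0,1)}.
            partial_deriv i L (bracket a \<alpha> \<beta> l y x) * (\<tau> \<bullet> i))
          \<le> L (bracket a \<alpha> \<beta> l y x + \<tau>) - L (bracket a \<alpha> \<beta> l y x)"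
        by (rule convex_in_varsD[OF assms(11)])
      then have "Ly x * h x + Lv x * V x + Lw x * W x + Lz x * (indef a \<alpha> \<beta> l u x - indef a \<alpha> \<beta> l y x)
          \<le> L (bracket a \<alpha> \<beta> l u x) - L (bracket a \<alpha> \<beta> l y x)"
        unfolding \<tau> by (simp add: \<tau>_def Ly_def Lv_def Lw_def Lz_def)
      then show ?thesis using Z[OF x] by (simp add: E_def)
    qed
    have "0 \<le> (LINT x:{a..b}|lebesgue. L (bracket a \<alpha> \<beta> l u x) - L (bracket a \<alpha> \<beta> l y x))"
      unfolding zero[symmetric]
      by (rule set_integral_mono) (use E_int E_le ci[OF cL[OF u]] ci[OF cL[OF y]] in auto)
    also have "\<dots> = functional_J a b \<alpha> \<beta> L l u - functional_J a b \<alpha> \<beta> L l y"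
      unfolding functional_J_def
      by (rule set_integral_diff(2)) (intro ci cL u y)+
    finally show ?thesis by simp
  qed
  then show ?thesis
    unfolding is_arg_min_def using assms(7-9) by (auto simp: not_less)
qed

end
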